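(* Let $X\subset\mathbb{R}^d$ be the self-similar set of a self-similar iterated function system $(\varphi_i)_{i=1}^m$ satisfying the open set condition, let $s=\dim_{\mathrm H} X$, and let $\mu$ be a self-similar measure fully supported on $X$, associated to this system and a probability vector $(p_1,\ldots,p_m)$ with all $p_i>0$. Suppose that $\mu$ is not doubling. Let $D(\mu)=\{x\in\operatorname{spt}(\mu): \mu \text{ is doubling at } x\}$. Then (1) $\dim_{\mathrm H} D(\mu)=s$, and (2) $\mathcal{H}^s(D(\mu))=0$, where $\dim_{\mathrm H}$ denotes Hausdorff dimension and $\mathcal{H}^s$ denotes $s$-dimensional Hausdorff measure.
   Context: A self-similar iterated function system (IFS) is a finite collection $(\varphi_i)_{i=1}^m$ of contractive similarities of $\mathbb{R}^d$, with contraction ratios $r_i\in(0,1)$. Its self-similar set is the unique non-empty compact $X\subset\mathbb{R}^d$ with $X=\bigcup_{i=1}^m\varphi_i(X)$; it is normalised so that $\operatorname{diam}(X)=1$ (so $m\ge 2$) and carries the Euclidean metric. The system (or $X$) satisfies the open set condition (OSC) if there is a non-empty bounded open set $U\subset\mathbb{R}^d$ with $\varphi_i(U)\subset U$ for all $i$ and $\varphi_i(U)\cap\varphi_j(U)=\emptyset$ for all $i\neq j$. The self-similar measure associated to the IFS and to a probability vector $(p_1,\ldots,p_m)$ with all $p_i>0$ is the unique Borel probability measure $\mu$ with $\mu=\sum_{i=1}^m p_i\,\mu\circ\varphi_i^{-1}$; its support is $X$. $B(x,r)$ denotes the closed ball of centre $x$ and radius $r$. The measure $\mu$ is doubling if there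 is a constant $C>0$ such that $\mu(B(x,2r))\le C\mu(B(x,r))$ for all $x\in X$ and $r>0$. It is (pointwise) doubling at $x$ if there is $0<C(x)<\infty$ such that $\mu(B(x,2r))\le C(x)\mu(B(x,r))$ for all $r>0$. *)

theory Defs
  imports "HOL-Probability.Probability"
begin

text \<open>
  The term contributed by a covering set: \<open>(diam U)\<^sup>s\<close>, with the usual conventions that the empty set
  contributes nothing and that \<open>0\<^sup>0 = 1\<close> for non-empty \<open>U\<close>, so that the case \<open>s = 0\<close> gives counting
  measure (whereas \<^term>\<open>0 powr 0 = (0::real)\<close>).
\<close>

definition diam_power :: "real \<Rightarrow> 'a::metric_space set \<Rightarrow> ennreal" where
  "diam_power s U = (if U = {} then 0 else if s = 0 then 1 else ennreal (diameter U powr s))"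

text \<open>
  Boundedness of the covering sets is required explicitly because \<^const>\<open>diameter\<close> has no meaningful
  value on unbounded sets. Finite covers are included, as the covering sets may be empty.
\<close>

definition hausdorff_premeasure :: "real \<Rightarrow> real \<Rightarrow> 'a::metric_space set \<Rightarrow> ennreal" where
  "hausdorff_premeasure s \<delta> A =
     (INF U \<in> {U :: nat \<Rightarrow> 'a set. A \<subseteq> (\<Union>i. U i) \<and> (\<forall>i. bounded (U i) \<and> diameter (U i) \<le> \<delta>)}.
        \<Sum>i. diam_power s (U i))"

text \<open>Hausdorff (outer) measure, defined on arbitrary subsets, without normalising constant.\<close>

definition hausdorff_measure :: "real \<Rightarrow> 'a::metric_space set \<Rightarrow> ennreal" where
  "hausdorff_measure s A = (SUP \<delta> \<in> {0<..}. hausdorff_premeasure s \<delta> A)"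

definition hausdorff_dim :: "'a::metric_space set \<Rightarrow> ennreal" where
  "hausdorff_dim A = Inf {ennreal s | s. 0 \<le> s \<and> hausdorff_measure s A = 0}"

definition contractive_similarity :: "real \<Rightarrow> ('a::metric_space \<Rightarrow> 'a) \<Rightarrow> bool" where
  "contractive_similarity r f \<longleftrightarrow> 0 < r \<and> r < 1 \<and> (\<forall>x y. dist (f x) (f y) = r * dist x y)"

definition self_similar_ifs ::
    "nat \<Rightarrow> (nat \<Rightarrow> real) \<Rightarrow> (nat \<Rightarrow> 'a::euclidean_space \<Rightarrow> 'a) \<Rightarrow> bool" where
  "self_similar_ifs m r \<phi> \<longleftrightarrow> (\<forall>i\<in>{1..m}. contractive_similarity (r i) (\<phi> i))"

definition self_similar_set ::
    "nat \<Rightarrow> (nat \<Rightarrow> 'a::euclidean_space \<Rightarrow> 'a) \<Rightarrow> 'a set \<Rightarrow> bool" where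
  "self_similar_set m \<phi> X \<longleftrightarrow> X \<noteq> {} \<and> compact X \<and> X = (\<Union>i\<in>{1..m}. \<phi> i ` X)"

definition open_set_condition :: "nat \<Rightarrow> (nat \<Rightarrow> 'a::euclidean_space \<Rightarrow> 'a) \<Rightarrow> bool" where
  "open_set_condition m \<phi> \<longleftrightarrow>
     (\<exists>U. U \<noteq> {} \<and> bounded U \<and> open U \<and>
          (\<forall>i\<in>{1..m}. \<phi> i ` U \<subseteq> U) \<and>
          (\<forall>i\<in>{1..m}. \<forall>j\<in>{1..m}. i \<noteq> j \<longrightarrow> \<phi> i ` U \<inter> \<phi> j ` U = {}))"

definition positive_probability_vector :: "nat \<Rightarrow> (nat \<Rightarrow> real) \<Rightarrow> bool" where
  "positive_probability_vector m p \<longleftrightarrow> (\<forall>i\<in>{1..m}. 0 < p i) \<and> (\<Sum>i=1..m. p i) = 1"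

definition self_similar_measure ::
    "nat \<Rightarrow> (nat \<Rightarrow> 'a::euclidean_space \<Rightarrow> 'a) \<Rightarrow> (nat \<Rightarrow> real) \<Rightarrow> 'a measure \<Rightarrow> bool" where
  "self_similar_measure m \<phi> p \<mu> \<longleftrightarrow>
     prob_space \<mu> \<and> sets \<mu> = sets borel \<and>
     (\<forall>A\<in>sets borel. measure \<mu> A = (\<Sum>i=1..m. p i * measure \<mu> (\<phi> i -` A)))"

definition measure_support :: "'a::topological_space measure \<Rightarrow> 'a set" where
  "measure_support \<mu> = {x. \<forall>U. open U \<and> x \<in> U \<longrightarrow> emeasure \<mu> U > 0}"

definition doubling_measure_on :: "'a::metric_space set \<Rightarrow> 'a measure \<Rightarrow> bool" where
  "doubling_measure_on X \<mu> \<longleftrightarrow>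
     (\<exists>C>0. \<forall>x\<in>X. \<forall>r>0. measure \<mu> (cball x (2 * r)) \<le> C * measure \<mu> (cball x r))"

definition doubling_at :: "'a::metric_space measure \<Rightarrow> 'a \<Rightarrow> bool" where
  "doubling_at \<mu> x \<longleftrightarrow>
     (\<exists>C>0. \<forall>r>0. measure \<mu> (cball x (2 * r)) \<le> C * measure \<mu> (cball x r))"

definition doubling_points :: "'a::metric_space measure \<Rightarrow> 'a set" where
  "doubling_points \<mu> = {x \<in> measure_support \<mu>. doubling_at \<mu> x}"

end

theory Submission
  imports Defs "HOL-Library.Sublist"
begin

text \<open>
  Let \<open>t\<close> be the similarity dimension, \<open>\<Sum> r\<^sub>i\<^sup>t = 1\<close>. Following Schief, a word \<open>w\<close> whose cylinder has
  the maximal number of neighbours of comparable size has the property that near the cylinder of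
  any word \<open>k w\<close> the measure \<open>\<mu>\<close> is just the scaled copy \<open>p\<^sub>k \<mu> \<circ> \<phi>\<^sub>k\<^sup>-\<^sup>1\<close> of itself.

  If \<open>\<mu>\<close> is very far from doubling on a ball \<open>B\<close>, choose a cylinder \<open>a\<close> inside \<open>B\<close> of comparable
  size. By the property of \<open>w\<close>, the failure of doubling is reproduced at every point of every
  cylinder \<open>k a w\<close>. Hence the points that are doubling with a fixed constant have codings avoiding
  some word \<open>u = a w\<close>, and splitting codings into blocks of length \<open>|u|\<close> covers them by cylinders
  with \<open>\<Sum> r\<^sup>t = (1 - r\<^sub>u\<^sup>t)\<^sup>N \<rightarrow> 0\<close>.

  Conversely, points whose codings are concatenations of blocks \<open>b w\<close> with \<open>|b| = N\<close> see the copies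
  of \<open>\<mu>\<close> at all scales up to bounded factors, so \<open>\<mu>\<close> is doubling there; as \<open>N \<rightarrow> \<infinity>\<close>, the similarity
  dimension of this subsystem tends to \<open>t\<close>. Positivity of its Hausdorff measure comes from
  compactness and Kraft's inequality for covering sets of words, without a mass distribution.
\<close>

section \<open>Words over a finite alphabet\<close>

definition words :: "'i set \<Rightarrow> nat \<Rightarrow> 'i list set" where
  "words I n = {w. set w \<subseteq> I \<and> length w = n}"

lemma finite_words: "finite I \<Longrightarrow> finite (words I n)"
  unfolding words_def by (rule finite_lists_length_eq)

lemma words_0 [simp]: "words I 0 = {[]}"
  by (auto simp: words_def)

lemma words_Suc: "words I (Suc n) = (\<lambda>(i, w). i # w) ` (I \<times> words I n)"
  by (auto simp: words_def length_Suc_conv image_iff)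

lemma sum_words_Suc:
  "(\<Sum>w\<in>words I (Suc n). g w) = (\<Sum>i\<in>I. \<Sum>w\<in>words I n. g (i # w))"
  unfolding words_Suc
  by (subst sum.reindex) (auto simp: inj_on_def sum.cartesian_product intro!: sum.cong)

lemma sum_words_prod_list:
  fixes f :: "'i \<Rightarrow> 'b::comm_semiring_1"
  shows "(\<Sum>w\<in>words I n. prod_list (map f w)) = (\<Sum>i\<in>I. f i) ^ n"
  by (induction n) (simp_all add: sum_words_Suc sum_distrib_left[symmetric] sum_distrib_right[symmetric])

lemma prod_list_map_powr:
  fixes f :: "'i \<Rightarrow> real"
  shows "(\<And>i. i \<in> set w \<Longrightarrow> 0 < f i) \<Longrightarrow> prod_list (map (\<lambda>i. f i powr t) w) = prod_list (map f w) powr t"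
proof (induction w)
  case (Cons i w)
  have "0 \<le> prod_list (map f w)"
    using Cons.prems by (intro prod_list_nonneg) (auto intro: less_imp_le)
  with Cons show ?case
    by (simp add: powr_mult less_imp_le)
qed simp

lemma prod_list_lower_bound:
  fixes f :: "'i \<Rightarrow> real"
  assumes "finite I" and f: "\<And>i. i \<in> I \<Longrightarrow> 0 < f i"
  shows "\<exists>b>0. b \<le> 1 \<and> (\<forall>w. set w \<subseteq> I \<longrightarrow> b ^ length w \<le> prod_list (map f w))"
proof -
  define b where "b = Min (insert 1 (f ` I))"
  have b: "0 < b" "b \<le> 1" "\<And>i. i \<in> I \<Longrightarrow> b \<le> f i"
    using assms by (auto simp: b_def)
  have "b ^ length w \<le> prod_list (map f w)" if "set w \<subseteq> I" for w
    using that
  proof (induction w)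
    case (Cons i w)
    then show ?case using b f[of i] by (auto intro!: mult_mono)
  qed simp
  with b show ?thesis by blast
qed

lemma sum_UNION_le:
  fixes f :: "'b \<Rightarrow> real"
  assumes "finite J" "\<And>j. j \<in> J \<Longrightarrow> finite (A j)" "\<And>j x. j \<in> J \<Longrightarrow> x \<in> A j \<Longrightarrow> 0 \<le> f x"
  shows "sum f (\<Union>j\<in>J. A j) \<le> (\<Sum>j\<in>J. sum f (A j))"
  using assms
proof (induction J rule: finite_induct)
  case (insert j J)
  have "sum f (A j \<union> (\<Union>j\<in>J. A j)) \<le> sum f (A j) + sum f (\<Union>j\<in>J. A j)"
    using insert by (subst sum_Un) (auto intro!: sum_nonneg)
  with insert show ?case by fastforce
qed simp

text \<open>Divide \<open>q\<close> by its sum \<open>S\<close> to get a probability vector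
  \<open>q'\<close>. The words of length \<open>n\<close> then have total mass 1, and those
  extending a given \<open>w\<close> have at most the mass of \<open>w\<close>. As
  \<open>S \<ge> 1\<close>, returning to \<open>q\<close> only enlarges the products.\<close>

lemma kraft_inequality_covering:
  fixes q :: "'i \<Rightarrow> real"
  assumes "finite I" and q: "\<And>i. i \<in> I \<Longrightarrow> 0 < q i" and q1: "(\<Sum>i\<in>I. q i) \<ge> 1"
    and "finite W" and cov: "\<And>v. v \<in> words I n \<Longrightarrow> \<exists>w\<in>W. prefix w v"
  shows "1 \<le> (\<Sum>w\<in>{w\<in>W. set w \<subseteq> I}. prod_list (map q w))"
proof -
  define S where "S = (\<Sum>i\<in>I. q i)"
  define q' where "q' i = q i / S" for i
  have S: "S \<ge> 1" using q1 S_def by simp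
  have q': "0 < q' i" "q' i \<le> q i" if "i \<in> I" for i
    using q[OF that] S by (auto simp: q'_def field_simps)
  have q'1: "(\<Sum>i\<in>I. q' i) = 1"
    unfolding q'_def using S by (simp add: S_def flip: sum_divide_distrib)
  have pos: "0 \<le> prod_list (map q' w)" if "set w \<subseteq> I" for w
    using that q' by (intro prod_list_nonneg) (auto intro: less_imp_le)
  have le: "prod_list (map q' w) \<le> prod_list (map q w)" if "set w \<subseteq> I" for w
    using that
  proof (induction w)
    case (Cons i w)
    then show ?case using q'[of i] q[of i] pos[of w]
      by (auto intro!: mult_mono)
  qed simp
  let ?W = "{w\<in>W. set w \<subseteq> I}"
  have fin: "finite {v \<in> words I n. prefix w v}" for w
    using finite_words[OF \<open>finite I\<close>] by simp
  have "1 = (\<Sum>v\<in>words I n. prod_list (map q' v))"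
    by (simp add: sum_words_prod_list q'1)
  also have "\<dots> \<le> (\<Sum>v\<in>(\<Union>w\<in>?W. {v \<in> words I n. prefix w v}). prod_list (map q' v))"
  proof (rule sum_mono2)
    show "words I n \<subseteq> (\<Union>w\<in>?W. {v \<in> words I n. prefix w v})"
    proof
      fix v assume v: "v \<in> words I n"
      with cov obtain w where "w \<in> W" "prefix w v" by blast
      then show "v \<in> (\<Union>w\<in>?W. {v \<in> words I n. prefix w v})"
        using v by (auto simp: words_def dest: set_mono_prefix)
    qed
  qed (use \<open>finite W\<close> fin pos in \<open>auto simp: words_def\<close>)
  also have "\<dots> \<le> (\<Sum>w\<in>?W. \<Sum>v\<in>{v \<in> words I n. prefix w v}. prod_list (map q' v))"
    using \<open>finite W\<close> fin pos
    by (intro sum_UNION_le) (auto simp: words_def)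
  also have "\<dots> \<le> (\<Sum>w\<in>?W. prod_list (map q' w))"
  proof (rule sum_mono)
    fix w assume w: "w \<in> ?W"
    \<comment> \<open>If \<open>w\<close> is longer than \<open>n\<close>, the left sum is empty, so
      the truncated difference \<open>n - length w\<close> does no harm.\<close>
    have "(\<Sum>v\<in>{v \<in> words I n. prefix w v}. prod_list (map q' v))
        \<le> (\<Sum>v\<in>(\<lambda>u. w @ u) ` words I (n - length w). prod_list (map q' v))"
      using w pos finite_words[OF \<open>finite I\<close>]
      by (intro sum_mono2 finite_imageI) (auto simp: words_def prefix_def)
    also have "\<dots> = prod_list (map q' w) * (\<Sum>u\<in>words I (n - length w). prod_list (map q' u))"
      by (subst sum.reindex) (auto simp: inj_on_def sum_distrib_left)
    also have "\<dots> = prod_list (map q' w)"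
      by (simp add: sum_words_prod_list q'1)
    finally show "(\<Sum>v\<in>{v \<in> words I n. prefix w v}. prod_list (map q' v)) \<le> prod_list (map q' w)" .
  qed
  also have "\<dots> \<le> (\<Sum>w\<in>?W. prod_list (map q w))"
    by (intro sum_mono le) auto
  finally show ?thesis .
qed

section \<open>Hausdorff measure\<close>

lemma diam_power_pos: "0 < s \<Longrightarrow> diam_power s U = ennreal (diameter U powr s)"
  by (simp add: diam_power_def)

lemma diam_power_empty [simp]: "diam_power s {} = 0"
  by (simp add: diam_power_def)

lemma hausdorff_premeasure_lower:
  "A \<subseteq> (\<Union>i. U i) \<Longrightarrow> (\<And>i. bounded (U i) \<and> diameter (U i) \<le> \<delta>)
    \<Longrightarrow> hausdorff_premeasure s \<delta> A \<le> (\<Sum>i. diam_power s (U i))"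
  unfolding hausdorff_premeasure_def by (rule INF_lower) auto

lemma hausdorff_premeasure_less_obtain:
  assumes "hausdorff_premeasure s \<delta> A < e"
  obtains U where "A \<subseteq> (\<Union>i. U i)" "\<And>i. bounded (U i)" "\<And>i. diameter (U i) \<le> \<delta>"
    "(\<Sum>i. diam_power s (U i)) < e"
  using assms unfolding hausdorff_premeasure_def INF_less_iff by blast

text \<open>Finite covers become sequences by padding with empty sets, which cost nothing.\<close>

lemma hausdorff_premeasure_le_sum:
  assumes W: "finite W" and A: "A \<subseteq> (\<Union>w\<in>W. V w)" and "0 \<le> \<delta>"
    and V: "\<And>w. w \<in> W \<Longrightarrow> bounded (V w) \<and> diameter (V w) \<le> \<delta>"
  shows "hausdorff_premeasure s \<delta> A \<le> (\<Sum>w\<in>W. diam_power s (V w))"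
proof -
  obtain f where f: "bij_betw f {0..<card W} W"
    using ex_bij_betw_nat_finite[OF W] by blast
  define U where "U i = (if i \<in> {0..<card W} then V (f i) else {})" for i
  have "A \<subseteq> (\<Union>i. U i)"
  proof
    fix x assume "x \<in> A"
    then obtain w where "w \<in> W" "x \<in> V w" using A by blast
    moreover obtain i where "i \<in> {0..<card W}" "f i = w"
      using \<open>w \<in> W\<close> f by (metis bij_betw_imp_surj_on imageE)
    ultimately have "x \<in> U i" by (auto simp: U_def)
    then show "x \<in> (\<Union>i. U i)" by blast
  qed
  moreover have "bounded (U i) \<and> diameter (U i) \<le> \<delta>" for i
    using V[OF bij_betwE[OF f, rule_format, of i]] \<open>0 \<le> \<delta>\<close> by (simp add: U_def)
  ultimately have "hausdorff_premeasure s \<delta> A \<le> (\<Sum>i. diam_power s (U i))"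
    by (rule hausdorff_premeasure_lower)
  also have "\<dots> = (\<Sum>i\<in>{0..<card W}. diam_power s (U i))"
    by (rule suminf_finite) (auto simp: U_def)
  also have "\<dots> = (\<Sum>i\<in>{0..<card W}. diam_power s (V (f i)))"
    by (auto simp: U_def)
  also have "\<dots> = (\<Sum>w\<in>W. diam_power s (V w))"
    using f by (rule sum.reindex_bij_betw)
  finally show ?thesis .
qed

lemma hausdorff_measure_mono: "A \<subseteq> B \<Longrightarrow> hausdorff_measure s A \<le> hausdorff_measure s B"
  unfolding hausdorff_measure_def hausdorff_premeasure_def
  by (intro SUP_mono' INF_superset_mono) auto

lemma hausdorff_premeasure_le_measure:
  "0 < \<delta> \<Longrightarrow> hausdorff_premeasure s \<delta> A \<le> hausdorff_measure s A"
  unfolding hausdorff_measure_def by (rule SUP_upper) auto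

lemma hausdorff_measure_eq_0I:
  assumes "\<And>\<delta> e. 0 < \<delta> \<Longrightarrow> 0 < e \<Longrightarrow> hausdorff_premeasure s \<delta> A \<le> ennreal e"
  shows "hausdorff_measure s A = 0"
proof -
  have "hausdorff_premeasure s \<delta> A \<le> 0" if "\<delta> > 0" for \<delta>
  proof (rule ennreal_le_epsilon)
    fix e :: real assume "0 < e"
    from assms[OF that this] show "hausdorff_premeasure s \<delta> A \<le> 0 + ennreal e" by simp
  qed
  then have "hausdorff_measure s A \<le> 0"
    unfolding hausdorff_measure_def by (intro SUP_least) simp
  then show ?thesis by simp
qed

lemma suminf_ennreal_geometric: "0 \<le> e \<Longrightarrow> (\<Sum>n. ennreal (e * (1/2) ^ Suc n)) = ennreal e"
proof -
  assume "0 \<le> e"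
  have "(\<lambda>n. e * (1/2) ^ Suc n) sums (e * 1)"
    using power_half_series by (rule sums_mult)
  then have "(\<Sum>n. ennreal (e * (1/2) ^ Suc n)) = ennreal (e * 1)"
    using \<open>0 \<le> e\<close> by (intro suminf_ennreal_eq) auto
  then show ?thesis by simp
qed

lemma hausdorff_measure_UN_null:
  fixes A :: "nat \<Rightarrow> 'a::metric_space set"
  assumes "\<And>n. hausdorff_measure s (A n) = 0"
  shows "hausdorff_measure s (\<Union>n. A n) = 0"
proof (rule hausdorff_measure_eq_0I)
  fix \<delta> e :: real assume \<delta>: "0 < \<delta>" and e: "0 < e"
  have "\<exists>U :: nat \<Rightarrow> 'a set. A n \<subseteq> (\<Union>i. U i) \<and> (\<forall>i. bounded (U i) \<and> diameter (U i) \<le> \<delta>) \<and>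
      (\<Sum>i. diam_power s (U i)) < ennreal (e * (1/2) ^ Suc n)" for n
  proof -
    have "hausdorff_premeasure s \<delta> (A n) < ennreal (e * (1/2) ^ Suc n)"
      by (rule le_less_trans[OF hausdorff_premeasure_le_measure[OF \<delta>]]) (use assms e in auto)
    then show ?thesis by (rule hausdorff_premeasure_less_obtain) auto
  qed
  then obtain U :: "nat \<Rightarrow> nat \<Rightarrow> 'a set" where U: "\<And>n. A n \<subseteq> (\<Union>i. U n i)"
      "\<And>n i. bounded (U n i) \<and> diameter (U n i) \<le> \<delta>"
      "\<And>n. (\<Sum>i. diam_power s (U n i)) < ennreal (e * (1/2) ^ Suc n)"
    by metis
  define V where "V k = (case prod_decode k of (n, i) \<Rightarrow> U n i)" for k
  have "hausdorff_premeasure s \<delta> (\<Union>n. A n) \<le> (\<Sum>k. diam_power s (V k))"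
  proof (rule hausdorff_premeasure_lower)
    show "(\<Union>n. A n) \<subseteq> (\<Union>k. V k)"
    proof
      fix x assume "x \<in> (\<Union>n. A n)"
      then obtain n i where "x \<in> U n i" using U(1) by blast
      then have "x \<in> V (prod_encode (n, i))" by (simp add: V_def)
      then show "x \<in> (\<Union>k. V k)" by blast
    qed
  qed (auto simp: V_def U(2) split: prod.split)
  also have "\<dots> = (\<Sum>k. (\<lambda>(n, i). diam_power s (U n i)) (prod_decode k))"
    by (simp add: V_def split: prod.split) (simp add: case_prod_beta)
  also have "\<dots> = (\<Sum>n. \<Sum>i. diam_power s (U n i))"
    by (rule suminf_ennreal_2dimen[of "\<lambda>n. \<Sum>i. diam_power s (U n i)" "\<lambda>(n, i). diam_power s (U n i)"]) simp
  also have "\<dots> \<le> (\<Sum>n. ennreal (e * (1/2) ^ Suc n))"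
    by (intro suminf_le less_imp_le U(3)) auto
  also have "\<dots> = ennreal e" using e by (simp only: suminf_ennreal_geometric less_imp_le)
  finally show "hausdorff_premeasure s \<delta> (\<Union>n. A n) \<le> ennreal e" .
qed

text \<open>For exponent 0 every non-empty covering set costs 1. This settles the exponent 0 in the
  lower bound for the dimension.\<close>

lemma hausdorff_measure_0_eq_0_imp_empty:
  assumes "hausdorff_measure 0 A = 0"
  shows "A = {}"
proof (rule ccontr)
  assume "A \<noteq> {}"
  have "hausdorff_premeasure 0 1 A < 1"
    by (rule le_less_trans[OF hausdorff_premeasure_le_measure]) (use assms in auto)
  then obtain U where U: "A \<subseteq> (\<Union>i. U i)" "\<And>i. bounded (U i)" "\<And>i. diameter (U i) \<le> 1"
      "(\<Sum>i. diam_power 0 (U i)) < 1"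
    by (rule hausdorff_premeasure_less_obtain) (rule that)
  obtain i where "U i \<noteq> {}" using \<open>A \<noteq> {}\<close> U(1) by blast
  then have "1 = diam_power 0 (U i)" by (simp add: diam_power_def)
  also have "\<dots> = (\<Sum>j\<in>{i}. diam_power 0 (U j))" by simp
  also have "\<dots> \<le> (\<Sum>i. diam_power 0 (U i))" by (rule sum_le_suminf) auto
  finally show False using U(4) by simp
qed

lemma hausdorff_measure_empty [simp]: "hausdorff_measure s ({} :: 'a::metric_space set) = 0"
proof (rule hausdorff_measure_eq_0I)
  fix \<delta> e :: real assume "0 < \<delta>"
  then show "hausdorff_premeasure s \<delta> ({} :: 'a set) \<le> ennreal e"
    using hausdorff_premeasure_le_sum[of "{}" "{} :: 'a set" undefined \<delta> s] by simp
qed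

section \<open>Systems of similarities\<close>

text \<open>The index type is arbitrary so that words can later index a subsystem. \<open>X\<close>
  is assumed forward invariant rather than invariant, because it stays the reference set of
  subsystems whose own limit set may be smaller.\<close>

locale contractive_system =
  fixes I :: "'i set" and r :: "'i \<Rightarrow> real" and \<phi> :: "'i \<Rightarrow> 'a::euclidean_space \<Rightarrow> 'a" and X :: "'a set"
  assumes finite_I: "finite I"
    and similarity: "\<And>i. i \<in> I \<Longrightarrow> contractive_similarity (r i) (\<phi> i)"
    and X_ne: "X \<noteq> {}" and compact_X: "compact X"
    and dist_X_le: "\<And>x y. x \<in> X \<Longrightarrow> y \<in> X \<Longrightarrow> dist x y \<le> 1"
    and invariant: "\<And>i. i \<in> I \<Longrightarrow> \<phi> i ` X \<subseteq> X"
begin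

abbreviation comp :: "'i list \<Rightarrow> 'a \<Rightarrow> 'a" where "comp w \<equiv> foldr \<phi> w"

abbreviation ratio :: "'i list \<Rightarrow> real" where "ratio w \<equiv> prod_list (map r w)"

lemma r_pos: "i \<in> I \<Longrightarrow> 0 < r i" and r_less_1: "i \<in> I \<Longrightarrow> r i < 1"
  using similarity by (auto simp: contractive_similarity_def)

lemma dist_comp: "set w \<subseteq> I \<Longrightarrow> dist (comp w x) (comp w y) = ratio w * dist x y"
  using similarity by (induction w) (auto simp: contractive_similarity_def)

lemma ratio_pos: "set w \<subseteq> I \<Longrightarrow> 0 < ratio w"
  using r_pos by (induction w) auto

lemma ratio_le_1: "set w \<subseteq> I \<Longrightarrow> ratio w \<le> 1"
proof (induction w)
  case (Cons i w)
  then show ?case using r_pos[of i] r_less_1[of i] ratio_pos[of w]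
    by (auto intro!: mult_le_one)
qed simp

lemma ratio_less_1: "set w \<subseteq> I \<Longrightarrow> w \<noteq> [] \<Longrightarrow> ratio w < 1"
proof (cases w)
  case (Cons i v)
  assume "set w \<subseteq> I"
  then have "r i * ratio v \<le> r i * 1" "r i < 1"
    using Cons ratio_le_1[of v] r_pos[of i] r_less_1[of i] by (auto intro!: mult_left_mono simp del: mult_1_right)
  then show ?thesis using Cons by simp
qed simp

lemma inj_comp: "set w \<subseteq> I \<Longrightarrow> inj (comp w)"
  by (rule injI) (metis dist_comp dist_eq_0_iff mult_eq_0_iff ratio_pos less_irrefl)

lemma continuous_comp: "set w \<subseteq> I \<Longrightarrow> continuous_on S (comp w)"
proof -
  assume w: "set w \<subseteq> I"
  have "lipschitz_on (ratio w) S (comp w)"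
    using ratio_pos[OF w] dist_comp[OF w] by (intro lipschitz_onI) auto
  then show ?thesis by (rule lipschitz_on_continuous_on)
qed

text \<open>Subtracting the value at 0 turns a similarity into an injective linear map, which is
  onto in finite dimension.\<close>

lemma surj_comp: "set w \<subseteq> I \<Longrightarrow> surj (comp w)"
proof -
  assume w: "set w \<subseteq> I"
  define f where "f x = comp w x - comp w 0" for x
  have "linear f"
    using dist_comp[OF w] by (intro scaling_linear[where c = "ratio w"]) (auto simp: f_def dist_norm)
  moreover have "inj f"
    using inj_comp[OF w] by (auto simp: f_def inj_on_def)
  ultimately have "surj f"
    using linear_injective_imp_surjective by blast
  then show ?thesis
    unfolding surj_def f_def by (metis diff_add_cancel add_diff_cancel)
qed

lemma vimage_comp_cball:
  assumes w: "set w \<subseteq> I"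
  shows "comp w -` cball (comp w x) (ratio w * \<rho>) = cball x \<rho>"
  using ratio_pos[OF w] dist_comp[OF w] by auto

lemma image_comp_subset: "set w \<subseteq> I \<Longrightarrow> comp w ` X \<subseteq> X"
proof (induction w)
  case (Cons i w)
  then show ?case using invariant[of i] by fastforce
qed simp

lemma image_comp_append_subset: "set v \<subseteq> I \<Longrightarrow> comp (w @ v) ` X \<subseteq> comp w ` X"
  using image_comp_subset[of v] by fastforce

lemma dist_image_comp_le:
  "set w \<subseteq> I \<Longrightarrow> x \<in> comp w ` X \<Longrightarrow> y \<in> comp w ` X \<Longrightarrow> dist x y \<le> ratio w"
  using dist_X_le dist_comp ratio_pos by (auto simp: mult_left_le less_imp_le)

lemma contraction_bound:
  "\<exists>c. 0 < c \<and> c < 1 \<and> (\<forall>w. set w \<subseteq> I \<longrightarrow> ratio w \<le> c ^ length w)"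
proof -
  define c where "c = Max (insert (1/2) (r ` I))"
  have c: "0 < c" "c < 1" "\<And>i. i \<in> I \<Longrightarrow> r i \<le> c"
    using finite_I r_less_1 by (auto simp: c_def less_max_iff_disj Max_gr_iff intro!: Max_ge)
  have "ratio w \<le> c ^ length w" if "set w \<subseteq> I" for w
    using that
  proof (induction w)
    case (Cons i w)
    then show ?case using c ratio_pos[of w] by (auto intro!: mult_mono)
  qed simp
  with c show ?thesis by blast
qed

lemma ratio_small:
  assumes "0 < \<rho>"
  shows "\<exists>n. \<forall>w. set w \<subseteq> I \<longrightarrow> n \<le> length w \<longrightarrow> ratio w \<le> \<rho>"
proof -
  obtain c where c: "0 < c" "c < 1" "\<And>w. set w \<subseteq> I \<Longrightarrow> ratio w \<le> c ^ length w"
    using contraction_bound by auto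
  obtain n where "c ^ n < \<rho>" using real_arch_pow_inv[OF assms c(2)] by blast
  then have "ratio w \<le> \<rho>" if "set w \<subseteq> I" "n \<le> length w" for w
    using c(3)[OF that(1)] power_decreasing[OF that(2), of c] c by linarith
  then show ?thesis by blast
qed

lemma ratio_lower_bound:
  "\<exists>b>0. b \<le> 1 \<and> (\<forall>w. set w \<subseteq> I \<longrightarrow> b ^ length w \<le> ratio w)"
  using prod_list_lower_bound[OF finite_I] r_pos by blast

section \<open>Stopping words: cylinders of a prescribed size\<close>

definition stopping_words :: "real \<Rightarrow> 'i list set" where
  "stopping_words \<rho> = {w. set w \<subseteq> I \<and> w \<noteq> [] \<and> ratio w \<le> \<rho> \<and> \<rho> < ratio (butlast w)}"

text \<open>Delete last letters of \<open>v\<close> as long as the ratio stays at most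
  \<open>\<rho>\<close>. The empty word has ratio 1, so \<open>\<rho> < 1\<close> stops this at a
  non-empty word; for \<open>\<rho> \<ge> 1\<close> there are no stopping words.\<close>

lemma prefix_stopping_words:
  assumes "set v \<subseteq> I" "ratio v \<le> \<rho>" "\<rho> < 1"
  shows "\<exists>w\<in>stopping_words \<rho>. prefix w v"
  using assms
proof (induction v rule: rev_induct)
  case (snoc i v)
  show ?case
  proof (cases "ratio v \<le> \<rho>")
    case True
    then show ?thesis using snoc by (auto intro: prefix_prefix)
  next
    case False
    then have "v @ [i] \<in> stopping_words \<rho>" using snoc by (auto simp: stopping_words_def)
    then show ?thesis by blast
  qed
qed simp

text \<open>If \<open>v\<close> properly extends \<open>w\<close>, then \<open>butlast v\<close>
  still extends \<open>w\<close>, so its ratio is at most \<open>\<rho>\<close>, against the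
  stopping rule for \<open>v\<close>.\<close>

lemma stopping_words_antichain:
  assumes w: "w \<in> stopping_words \<rho>" and v: "v \<in> stopping_words \<rho>" and "prefix w v"
  shows "w = v"
proof (rule ccontr)
  assume "w \<noteq> v"
  then obtain u i where u: "v = w @ u @ [i]"
    using \<open>prefix w v\<close> by (metis append_Nil2 prefix_def rev_exhaust)
  then have "set u \<subseteq> I" "ratio (butlast v) = ratio w * ratio u"
    using v by (auto simp: stopping_words_def butlast_append)
  then have "ratio (butlast v) \<le> ratio w * 1"
    using ratio_le_1[of u] ratio_pos[of w] w
    by (auto simp: stopping_words_def intro!: mult_left_mono)
  then show False using v w by (auto simp: stopping_words_def)
qed

lemma append_stopping_words:
  assumes "set k \<subseteq> I" "w \<in> stopping_words \<rho>"
  shows "k @ w \<in> stopping_words (ratio k * \<rho>)"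
  using assms ratio_pos[of k] by (auto simp: stopping_words_def butlast_append)

section \<open>Levels of the construction and the limit set\<close>

text \<open>The intersection of these decreasing compact sets is the limit set of the system, even
  when that is strictly smaller than \<open>X\<close>.\<close>

definition level :: "nat \<Rightarrow> 'a set" where
  "level n = (\<Union>w\<in>words I n. comp w ` X)"

lemma compact_level: "compact (level n)"
  unfolding level_def
  by (intro compact_UN finite_words finite_I compact_continuous_image continuous_comp compact_X)
    (auto simp: words_def)

lemma level_antimono: "m \<le> n \<Longrightarrow> level n \<subseteq> level m"
proof
  fix x assume "m \<le> n" "x \<in> level n"
  then obtain w where w: "w \<in> words I n" "x \<in> comp w ` X" by (auto simp: level_def)
  then have "set (drop m w) \<subseteq> I" using set_drop_subset[of m w] by (auto simp: words_def)
  from image_comp_append_subset[OF this, of "take m w"] have "x \<in> comp (take m w) ` X"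
    using w by auto
  moreover have "take m w \<in> words I m"
    using w \<open>m \<le> n\<close> set_take_subset[of m w] by (auto simp: words_def)
  ultimately show "x \<in> level m" by (auto simp: level_def)
qed

lemma diameter_image_comp_le: "set w \<subseteq> I \<Longrightarrow> diameter (comp w ` X) \<le> ratio w"
  using X_ne by (rule_tac diameter_le) (auto intro: dist_image_comp_le simp flip: dist_norm)

lemma bounded_image_comp: "set w \<subseteq> I \<Longrightarrow> bounded (comp w ` X)"
  by (intro compact_imp_bounded compact_continuous_image continuous_comp compact_X)

text \<open>The level \<open>n\<close> cylinders cover \<open>A\<close> and become arbitrarily
  small, and their ratios to the power \<open>t\<close> sum to the \<open>n\<close>-th power of a
  number below 1.\<close>

lemma hausdorff_measure_Inter_level_null:
  assumes "0 < t" and S: "(\<Sum>i\<in>I. r i powr t) < 1" and A: "\<And>n. A \<subseteq> level n"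
  shows "hausdorff_measure t A = 0"
proof (rule hausdorff_measure_eq_0I)
  fix \<delta> e :: real assume \<delta>: "0 < \<delta>" and e: "0 < e"
  let ?S = "\<Sum>i\<in>I. r i powr t"
  have S0: "0 \<le> ?S" by (intro sum_nonneg) auto
  obtain n1 where n1: "\<And>w. set w \<subseteq> I \<Longrightarrow> n1 \<le> length w \<Longrightarrow> ratio w \<le> \<delta>"
    using ratio_small[OF \<delta>] by blast
  obtain n2 where n2: "?S ^ n2 < e" using real_arch_pow_inv[OF e S] by blast
  define n where "n = max n1 n2"
  have "hausdorff_premeasure t \<delta> A \<le> (\<Sum>w\<in>words I n. diam_power t (comp w ` X))"
  proof (rule hausdorff_premeasure_le_sum)
    show "bounded (comp w ` X) \<and> diameter (comp w ` X) \<le> \<delta>" if "w \<in> words I n" for w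
      using that n1[of w] diameter_image_comp_le[of w] bounded_image_comp[of w]
      by (auto simp: words_def n_def)
  qed (use finite_I A[of n] \<delta> in \<open>auto simp: finite_words level_def\<close>)
  also have "\<dots> \<le> (\<Sum>w\<in>words I n. ennreal (ratio w powr t))"
    using \<open>0 < t\<close> diameter_image_comp_le diameter_ge_0[OF bounded_image_comp]
    by (intro sum_mono) (auto simp: diam_power_pos words_def intro!: ennreal_leI powr_mono2)
  also have "\<dots> = ennreal (\<Sum>w\<in>words I n. prod_list (map (\<lambda>i. r i powr t) w))"
    using r_pos by (subst sum_ennreal[symmetric])
      (auto simp: words_def prod_list_map_powr subset_iff intro!: sum.cong)
  also have "\<dots> = ennreal (?S ^ n)" by (simp add: sum_words_prod_list)
  also have "\<dots> \<le> ennreal e"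
    using n2 power_decreasing[of n2 n ?S] S S0 by (intro ennreal_leI) (auto simp: n_def)
  finally show "hausdorff_premeasure t \<delta> A \<le> ennreal e" .
qed

lemma foldr_foldr: "foldr comp V x = comp (concat V) x"
  by (induction V) auto

text \<open>Blocks become the letters of a new system over the same \<open>X\<close>. The empty
  block is excluded because its map is the identity.\<close>

lemma contractive_system_blocks:
  assumes "J \<subseteq> words I l" "[] \<notin> J"
  shows "contractive_system J ratio comp X"
proof
  show "finite J" using assms(1) finite_I by (metis finite_subset finite_words)
  show "contractive_similarity (ratio w) (comp w)" if "w \<in> J" for w
  proof -
    from that assms have "set w \<subseteq> I" "w \<noteq> []" by (auto simp: words_def)
    then show ?thesis
      using ratio_pos ratio_less_1 dist_comp by (auto simp: contractive_similarity_def)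
  qed
  show "comp w ` X \<subseteq> X" if "w \<in> J" for w
    using image_comp_subset[of w] that assms(1) by (auto simp: words_def)
qed (use X_ne compact_X dist_X_le in auto)

section \<open>The similarity dimension\<close>

lemma powr_sum_strict_antimono:
  assumes "I \<noteq> {}" "s < t"
  shows "(\<Sum>i\<in>I. r i powr t) < (\<Sum>i\<in>I. r i powr s)"
  using assms finite_I r_pos r_less_1 by (intro sum_strict_mono) (auto intro!: powr_less_mono')

text \<open>Intermediate value theorem: the sum is \<open>card I > 1\<close> at exponent 0 and at
  most 1 at an exponent \<open>n\<close> with \<open>c ^ n < 1 / card I\<close>.\<close>

lemma similarity_dimension_exists:
  assumes "2 \<le> card I"
  obtains t where "0 < t" "(\<Sum>i\<in>I. r i powr t) = 1"
proof -
  define f where "f t = (\<Sum>i\<in>I. r i powr t)" for t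
  obtain c where c: "0 < c" "c < 1" "\<And>w. set w \<subseteq> I \<Longrightarrow> ratio w \<le> c ^ length w"
    using contraction_bound by auto
  have "0 < 1 / real (card I)" using assms by simp
  then obtain n where n: "c ^ n < 1 / real (card I)" using real_arch_pow_inv c(2) by blast
  have "r i powr real n \<le> c ^ n" if "i \<in> I" for i
    using c(3)[of "[i]"] r_pos[OF that] that by (simp add: powr_realpow power_mono)
  then have "f (real n) \<le> real (card I) * c ^ n" unfolding f_def by (rule sum_bounded_above)
  also have "\<dots> \<le> 1" using n assms by (simp add: field_simps)
  finally have "f (real n) \<le> 1" .
  have f0: "f 0 = card I"
  proof -
    have "r i powr 0 = 1" if "i \<in> I" for i using r_pos[OF that] by simp
    then show ?thesis by (simp add: f_def)
  qed
  have "continuous_on {0..real n} f"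
    unfolding f_def by (intro continuous_intros) (auto dest: r_pos)
  then obtain t where t: "0 \<le> t" "f t = 1"
    using IVT2'[of f "real n" 1 0] \<open>f (real n) \<le> 1\<close> f0 assms by auto
  moreover have "t \<noteq> 0" using f0 t assms by auto
  ultimately show ?thesis using that[of t] by (auto simp: f_def)
qed

end

section \<open>The open set condition\<close>

locale osc_system = contractive_system I r \<phi> X
  for I :: "'i set" and r \<phi> and X :: "'a::euclidean_space set" +
  fixes U :: "'a set"
  assumes U_ne: "U \<noteq> {}" and U_bounded: "bounded U" and U_open: "open U"
    and U_sub: "\<And>i. i \<in> I \<Longrightarrow> \<phi> i ` U \<subseteq> U"
    and U_disj: "\<And>i j. i \<in> I \<Longrightarrow> j \<in> I \<Longrightarrow> i \<noteq> j \<Longrightarrow> \<phi> i ` U \<inter> \<phi> j ` U = {}"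
begin

lemma image_comp_U_subset: "set w \<subseteq> I \<Longrightarrow> comp w ` U \<subseteq> U"
proof (induction w)
  case (Cons i w)
  then show ?case using U_sub[of i] by fastforce
qed simp

text \<open>Cancel common first letters by injectivity. As the words are incomparable, a position
  with different letters is reached, and there \<open>U_disj\<close> applies.\<close>

lemma image_comp_U_disjoint:
  "\<lbrakk>set w \<subseteq> I; set v \<subseteq> I; \<not> prefix w v; \<not> prefix v w\<rbrakk> \<Longrightarrow> comp w ` U \<inter> comp v ` U = {}"
proof (induction w arbitrary: v)
  case (Cons i w)
  from Cons.prems obtain j v' where v: "v = j # v'" by (cases v) auto
  show ?case
  proof (cases "i = j")
    case True
    then have *: "comp w ` U \<inter> comp v' ` U = {}"
      using Cons v by auto
    have "inj (\<phi> i)" using inj_comp[of "[i]"] Cons.prems by simp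
    then show ?thesis using * v True by (auto simp: inj_def)
  next
    case False
    have "comp (i # w) ` U \<subseteq> \<phi> i ` U" "comp v ` U \<subseteq> \<phi> j ` U"
      using Cons.prems v image_comp_U_subset[of w] image_comp_U_subset[of v'] by auto
    then show ?thesis using U_disj[of i j] False Cons.prems v by fastforce
  qed
qed simp

text \<open>The balls of radius \<open>ratio w * \<eta>\<close> around the images of a point of \<open>U\<close> are disjoint, so
  the images are \<open>\<rho>\<close>-separated up to a constant and compactness of a rescaled ball bounds their number.\<close>

lemma stopping_words_card_bound:
  "\<exists>M\<ge>1. \<forall>x \<rho>. finite {w \<in> stopping_words \<rho>. comp w ` X \<inter> cball x (2 * \<rho>) \<noteq> {}} \<and>
      card {w \<in> stopping_words \<rho>. comp w ` X \<inter> cball x (2 * \<rho>) \<noteq> {}} \<le> M"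
proof -
  obtain u where "u \<in> U" using U_ne by blast
  then obtain \<eta> where \<eta>: "\<eta> > 0" "ball u \<eta> \<subseteq> U"
    using U_open by (meson open_contains_ball)
  obtain b where b: "0 < b" "b \<le> 1" 
      "\<And>w. set w \<subseteq> I \<Longrightarrow> b ^ length w \<le> ratio w"
    using ratio_lower_bound by auto
  obtain z where z: "z \<in> X" using X_ne by blast
  \<comment> \<open>In units of \<open>\<rho>\<close>, a point common to the cylinder and the ball
    is within 2 of \<open>x\<close> and within \<open>1 + dist z u\<close> of
    \<open>comp w u\<close>; this gives \<open>R\<close>. A stopping word has
    \<open>ratio w \<ge> b * \<rho>\<close>, as its last letter brings the ratio down from above
    \<open>\<rho>\<close>, so the rescaled images of \<open>u\<close> are \<open>2 * e\<close>
    apart.\<close>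
  define R where "R = 3 + dist z u"
  define e where "e = b * \<eta> / 2"
  have e: "e > 0" using b \<eta> by (simp add: e_def)
  obtain K where K: "finite K" "cball (0::'a) R \<subseteq> (\<Union>k\<in>K. ball k e)"
    using compact_cball[of "0::'a" R] e unfolding compact_eq_totally_bounded by blast
  have main: "finite (A x \<rho>) \<and> card (A x \<rho>) \<le> card K"
    if A: "A = (\<lambda>x \<rho>. {w \<in> stopping_words \<rho>. comp w ` X \<inter> cball x (2 * \<rho>) \<noteq> {}})" for A x \<rho>
  proof (cases "A x \<rho> = {}")
    case False
    then obtain w0 where "w0 \<in> stopping_words \<rho>" using A by auto
    then have \<rho>: "\<rho> > 0" using ratio_pos[of w0] by (auto simp: stopping_words_def)
    define g where "g w = (1 / \<rho>) *\<^sub>R (comp w u - x)" for w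
    have sep: "e * 2 \<le> dist (g w) (g v)" if "w \<in> A x \<rho>" "v \<in> A x \<rho>" "w \<noteq> v" for w v
    proof -
      have wv: "w \<in> stopping_words \<rho>" "v \<in> stopping_words \<rho>" using that A by auto
      then have I: "set w \<subseteq> I" "set v \<subseteq> I" by (auto simp: stopping_words_def)
      obtain w' i where w': "w = w' @ [i]" using wv(1)
        by (cases w rule: rev_cases) (auto simp: stopping_words_def)
      have "\<rho> * b \<le> ratio w' * r i"
        using wv(1) w' b(1) b(3)[of "[i]"] \<rho> by (intro mult_mono) (auto simp: stopping_words_def)
      then have rw: "\<rho> * b \<le> ratio w" using w' by simp
      have disj: "comp w ` U \<inter> comp v ` U = {}"
        using image_comp_U_disjoint[OF I] stopping_words_antichain wv that(3) by metis
      have "ratio w * \<eta> \<le> dist (comp w u) (comp v u)"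
      proof (rule ccontr)
        assume *: "\<not> ?thesis"
        obtain y where y: "comp w y = comp v u" using surj_comp[OF I(1)] by (metis surjD)
        have "ratio w * dist u y < ratio w * \<eta>"
          using dist_comp[OF I(1), of u y] y * by simp
        then have "y \<in> U" using \<eta> ratio_pos[OF I(1)] by (auto simp: subset_eq)
        then have "comp v u \<in> comp w ` U \<inter> comp v ` U" using y \<open>u \<in> U\<close> by force
        with disj show False by simp
      qed
      moreover have "\<rho> * b * \<eta> \<le> ratio w * \<eta>" using rw \<eta> by (intro mult_right_mono) auto
      moreover have "dist (g w) (g v) = (1/\<rho>) * dist (comp w u) (comp v u)"
        using \<rho> by (simp add: g_def dist_norm flip: scaleR_diff_right)
      ultimately have "\<rho> * (e * 2) \<le> \<rho> * dist (g w) (g v)" using \<rho> by (simp add: e_def mult_ac)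
      then show ?thesis using \<rho> by simp
    qed
    have inR: "g w \<in> cball 0 R" if w: "w \<in> A x \<rho>" for w
    proof -
      from w A obtain y where y: "y \<in> X" "dist x (comp w y) \<le> 2 * \<rho>" and ws: "w \<in> stopping_words \<rho>"
        by auto
      then have I: "set w \<subseteq> I" "ratio w \<le> \<rho>" by (auto simp: stopping_words_def)
      have "dist y u \<le> 1 + dist z u" using dist_X_le[OF y(1) z] dist_triangle[of y u z] by simp
      then have "dist (comp w y) (comp w u) \<le> \<rho> * (1 + dist z u)"
        using I \<rho> by (auto simp: dist_comp intro!: mult_mono)
      then have "dist x (comp w u) \<le> \<rho> * R"
        using y dist_triangle[of x "comp w u" "comp w y"] by (simp add: R_def algebra_simps)
      then have "norm (comp w u - x) \<le> \<rho> * R" by (simp add: dist_norm norm_minus_commute)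
      then show ?thesis using \<rho> by (simp add: g_def divide_le_eq mult_ac)
    qed
    have "\<exists>k\<in>K. dist k (g w) < e" if "w \<in> A x \<rho>" for w
    proof -
      have "g w \<in> (\<Union>k\<in>K. ball k e)" using inR[OF that] K(2) by (rule set_mp[rotated])
      then show ?thesis by auto
    qed
    then obtain k where k: "w \<in> A x \<rho> \<Longrightarrow> k w \<in> K \<and> dist (k w) (g w) < e" for w
      by metis
    \<comment> \<open>\<open>k\<close> picks a point of the finite \<open>e\<close>-net near
      \<open>g w\<close>; points \<open>2 * e\<close> apart cannot share one.\<close>
    have "inj_on k (A x \<rho>)"
    proof (rule inj_onI, rule ccontr)
      fix w v assume "w \<in> A x \<rho>" "v \<in> A x \<rho>" "k w = k v" "w \<noteq> v"
      then show False using sep[of w v] k[of w] k[of v] dist_triangle3[of "g w" "g v" "k w"] by simp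
    qed
    moreover have "k ` A x \<rho> \<subseteq> K" using k by auto
    ultimately show ?thesis using K(1)
      by (meson card_inj_on_le inj_on_finite)
  qed simp
  show ?thesis
    using main[OF refl] by (intro exI[of _ "Suc (card K)"]) (auto simp: le_SucI)
qed

text \<open>A cover of small cost is thickened to balls, which by compactness cover a whole level.
  The boundedly many cylinders of comparable size near each ball give a finite set of words in which
  every long word has a prefix, and Kraft's inequality bounds their cost below by 1.\<close>

lemma hausdorff_measure_Inter_level_pos:
  assumes t: "0 < t" and S: "(\<Sum>i\<in>I. r i powr t) \<ge> 1"
  shows "hausdorff_measure t (\<Inter>n. level n) \<noteq> 0"
proof
  assume null: "hausdorff_measure t (\<Inter>n. level n) = 0"
  define H where "H x \<rho> = {w \<in> stopping_words \<rho>. comp w ` X \<inter> cball x (2 * \<rho>) \<noteq> {}}" for x \<rho>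
  have "\<exists>M\<ge>1. \<forall>x \<rho>. finite (H x \<rho>) \<and> card (H x \<rho>) \<le> M"
    unfolding H_def by (rule stopping_words_card_bound)
  then obtain M where M: "M \<ge> 1" "\<And>x \<rho>. finite (H x \<rho>)" "\<And>x \<rho>. card (H x \<rho>) \<le> M"
    by blast
  \<comment> \<open>With this \<open>e\<close> the final bound \<open>real M * (2 * e)\<close> is 1,
    and \<open>e \<le> 1/2\<close> makes all radii \<open>\<rho> i\<close> smaller than 1.\<close>
  define e where "e = 1 / (2 * real M)"
  have e: "0 < e" "e \<le> 1/2" using M(1) by (auto simp: e_def field_simps)
  have "hausdorff_premeasure t 1 (\<Inter>n. level n) < ennreal e"
    by (rule le_less_trans[OF hausdorff_premeasure_le_measure]) (use null e in auto)
  then obtain C where C: "(\<Inter>n. level n) \<subseteq> (\<Union>i. C i)" "\<And>i. bounded (C i)"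
      "\<And>i. diameter (C i) \<le> 1" "(\<Sum>i. diam_power t (C i)) < ennreal e"
    by (rule hausdorff_premeasure_less_obtain) (rule that)
  define c where "c i = (SOME x. x \<in> C i)" for i
  have c: "c i \<in> C i" if "C i \<noteq> {}" for i using that by (simp add: c_def some_in_eq)
  define \<rho> where "\<rho> i = (diameter (C i) powr t + e * (1/2) ^ Suc i) powr (1 / t)" for i
  have D0: "0 \<le> diameter (C i)" for i using C(2) by (rule diameter_ge_0)
  have pos: "0 < diameter (C i) powr t + e * (1/2) ^ Suc i" for i
    using e by (intro add_nonneg_pos) auto
  have \<rho>pos: "0 < \<rho> i" for i using pos[of i] by (simp add: \<rho>_def)
  have \<rho>t: "\<rho> i powr t = diameter (C i) powr t + e * (1/2) ^ Suc i" for i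
    using pos[of i] t by (simp add: \<rho>_def powr_powr)
  have \<rho>D: "diameter (C i) < \<rho> i" for i
  proof (rule ccontr)
    assume "\<not> ?thesis"
    then have "\<rho> i powr t \<le> diameter (C i) powr t"
      using \<rho>pos[of i] t by (intro powr_mono2) auto
    moreover have "0 < e * (1/2) ^ Suc i" using e by simp
    ultimately show False using \<rho>t[of i] by linarith
  qed
  have sum: "(\<Sum>i\<in>J. \<rho> i powr t) < 2 * e" if "finite J" for J
  proof -
    have "ennreal (\<Sum>i\<in>J. \<rho> i powr t) = (\<Sum>i\<in>J. ennreal (\<rho> i powr t))"
      by (simp add: sum_ennreal)
    also have "\<dots> \<le> (\<Sum>i. ennreal (\<rho> i powr t))"
      using that by (intro sum_le_suminf) auto
    also have "\<dots> = (\<Sum>i. diam_power t (C i) + ennreal (e * (1/2) ^ Suc i))"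
      using e t by (simp add: \<rho>t diam_power_pos ennreal_plus del: power_Suc)
    also have "\<dots> = (\<Sum>i. diam_power t (C i)) + (\<Sum>i. ennreal (e * (1/2) ^ Suc i))"
      by (rule suminf_add[symmetric]) auto
    also have "\<dots> = (\<Sum>i. diam_power t (C i)) + ennreal e"
      using e by (simp only: suminf_ennreal_geometric less_imp_le)
    also have "\<dots> < ennreal e + ennreal e"
      using C(4) by (simp add: ennreal_add_left_cancel_less add.commute)
    also have "\<dots> = ennreal (2 * e)" using e by (simp flip: ennreal_plus)
    finally show ?thesis by (subst (asm) ennreal_less_iff) (auto intro: sum_nonneg)
  qed
  have \<rho>1: "\<rho> i < 1" for i
  proof (rule ccontr)
    assume "\<not> ?thesis"
    then have "1 \<le> \<rho> i powr t" using t by (intro ge_one_powr_ge_zero) auto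
    with sum[of "{i}"] e show False by simp
  qed
  define V where "V = (\<Union>i. ball (c i) (\<rho> i))"
  have "(\<Inter>n. level n) \<subseteq> V"
  proof
    fix x assume "x \<in> (\<Inter>n. level n)"
    then obtain i where i: "x \<in> C i" using C(1) by blast
    then have "dist (c i) x \<le> diameter (C i)" using c[of i] C(2) by (intro diameter_bounded_bound) auto
    then have "x \<in> ball (c i) (\<rho> i)" using \<rho>D[of i] by simp
    then show "x \<in> V" by (auto simp: V_def)
  qed
  \<comment> \<open>The sets \<open>level n - V\<close> are compact and decreasing with empty
    intersection, so one of them is empty.\<close>
  have "\<exists>n. level n - V = {}"
  proof (rule ccontr)
    assume "\<nexists>n. level n - V = {}"
    moreover have "open V" by (auto simp: V_def)
    ultimately have "\<Inter>(range (\<lambda>n. level n - V)) \<noteq> {}"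
      using compact_level level_antimono by (intro compact_nest compact_diff) blast+
    then show False using \<open>(\<Inter>n. level n) \<subseteq> V\<close> by blast
  qed
  then obtain n where n: "level n \<subseteq> (\<Union>i. ball (c i) (\<rho> i))" by (auto simp: V_def)
  obtain J where J: "finite J" "level n \<subseteq> (\<Union>i\<in>J. ball (c i) (\<rho> i))"
    using compactE_image[OF compact_level, of UNIV "\<lambda>i. ball (c i) (\<rho> i)" n] n by auto
  define W where "W i = H (c i) (\<rho> i)" for i
  \<comment> \<open>Words of ratio at most \<open>\<rho>0\<close> have a stopping prefix at every
    scale \<open>\<rho> i\<close> with \<open>i\<close> in \<open>J\<close>. The inserted 1 covers
    an empty \<open>J\<close>.\<close>
  define \<rho>0 where "\<rho>0 = Min (insert 1 (\<rho> ` J))"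
  have \<rho>0: "0 < \<rho>0" "\<And>i. i \<in> J \<Longrightarrow> \<rho>0 \<le> \<rho> i" using J(1) \<rho>pos by (auto simp: \<rho>0_def)
  obtain n1 where n1: "\<And>w. set w \<subseteq> I \<Longrightarrow> n1 \<le> length w \<Longrightarrow> ratio w \<le> \<rho>0"
    using ratio_small[OF \<rho>0(1)] by blast
  have cov: "\<exists>w\<in>(\<Union>i\<in>J. W i). prefix w v" if v: "v \<in> words I (max n n1)" for v
  proof -
    \<comment> \<open>Any point of the cylinder will do: the ball containing it determines the scale
      at which \<open>v\<close> is cut, and the cylinder of the resulting prefix meets that ball in
      \<open>x\<close>.\<close>
    obtain x where x: "x \<in> comp v ` X" using X_ne by blast
    then have "x \<in> level n" using v level_antimono[of n "max n n1"] by (auto simp: level_def)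
    then obtain i where i: "i \<in> J" "x \<in> ball (c i) (\<rho> i)" using J(2) by blast
    have "ratio v \<le> \<rho> i" "set v \<subseteq> I"
      using n1[of v] v \<rho>0(2)[OF i(1)] by (auto simp: words_def)
    then obtain w where w: "w \<in> stopping_words (\<rho> i)" "prefix w v"
      using prefix_stopping_words[of v "\<rho> i"] \<rho>1[of i] by blast
    then obtain u where u: "v = w @ u" by (auto simp: prefix_def)
    then have "x \<in> comp w ` X"
      using image_comp_append_subset[of u w] x \<open>set v \<subseteq> I\<close> by auto
    moreover have "x \<in> cball (c i) (2 * \<rho> i)" using i(2) \<rho>pos[of i] by auto
    ultimately have "w \<in> W i" using w(1) by (auto simp: W_def H_def)
    with i(1) w(2) show ?thesis by blast
  qed
  have WI: "set w \<subseteq> I" if "w \<in> W i" for w i using that by (auto simp: W_def H_def stopping_words_def)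
  have "1 \<le> (\<Sum>w\<in>{w\<in>(\<Union>i\<in>J. W i). set w \<subseteq> I}. prod_list (map (\<lambda>i. r i powr t) w))"
    using finite_I r_pos S J(1) M(2) cov
    by (intro kraft_inequality_covering) (auto simp: W_def less_le)
  also have "{w\<in>(\<Union>i\<in>J. W i). set w \<subseteq> I} = (\<Union>i\<in>J. W i)" using WI by auto
  also have "(\<Sum>w\<in>(\<Union>i\<in>J. W i). prod_list (map (\<lambda>i. r i powr t) w)) \<le>
      (\<Sum>i\<in>J. \<Sum>w\<in>W i. prod_list (map (\<lambda>i. r i powr t) w))"
    using J(1) M(2) by (intro sum_UNION_le) (auto simp: W_def intro!: prod_list_nonneg)
  also have "\<dots> \<le> (\<Sum>i\<in>J. real M * \<rho> i powr t)"
  proof (rule sum_mono)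
    fix i
    have "prod_list (map (\<lambda>i. r i powr t) w) \<le> \<rho> i powr t" if w: "w \<in> W i" for w
    proof -
      have "prod_list (map (\<lambda>i. r i powr t) w) = ratio w powr t"
        using WI[OF w] r_pos by (intro prod_list_map_powr) auto
      also have "\<dots> \<le> \<rho> i powr t"
        using w ratio_pos[of w] t by (intro powr_mono2) (auto simp: W_def H_def stopping_words_def)
      finally show ?thesis .
    qed
    then have "(\<Sum>w\<in>W i. prod_list (map (\<lambda>i. r i powr t) w)) \<le> real (card (W i)) * \<rho> i powr t"
      by (rule sum_bounded_above)
    also have "\<dots> \<le> real M * \<rho> i powr t"
      using M(3) by (intro mult_right_mono) (auto simp: W_def)
    finally show "(\<Sum>w\<in>W i. prod_list (map (\<lambda>i. r i powr t) w)) \<le> real M * \<rho> i powr t" .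
  qed
  also have "\<dots> = real M * (\<Sum>i\<in>J. \<rho> i powr t)" by (simp add: sum_distrib_left)
  also have "\<dots> < real M * (2 * e)" using sum[OF J(1)] M(1) by (intro mult_strict_left_mono) auto
  also have "\<dots> = 1" using M(1) by (simp add: e_def)
  finally show False by simp
qed

text \<open>Distinct blocks of equal length are incomparable, so the same \<open>U\<close> serves
  for the block system.\<close>

lemma osc_system_blocks:
  assumes J: "J \<subseteq> words I l" "[] \<notin> J"
  shows "osc_system J ratio comp X U"
proof -
  interpret B: contractive_system J ratio comp X by (rule contractive_system_blocks[OF J])
  show ?thesis
  proof
    show "comp w ` U \<subseteq> U" if "w \<in> J" for w
      using that J(1) image_comp_U_subset[of w] by (auto simp: words_def)
    show "comp w ` U \<inter> comp v ` U = {}" if "w \<in> J" "v \<in> J" "w \<noteq> v" for w v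
    proof (rule image_comp_U_disjoint)
      have "length w = length v" using that J(1) by (auto simp: words_def)
      then show "\<not> prefix w v" "\<not> prefix v w"
        using \<open>w \<noteq> v\<close> by (auto simp: prefix_def)
    qed (use that J(1) in \<open>auto simp: words_def\<close>)
  qed (use U_ne U_bounded U_open in auto)
qed

end

section \<open>Self-similar measures\<close>

locale self_similar_system = osc_system I r \<phi> X U
  for I :: "'i set" and r and \<phi> and X :: "'a::euclidean_space set" and U +
  fixes p :: "'i \<Rightarrow> real" and \<mu> :: "'a measure"
  assumes X_eq: "X = (\<Union>i\<in>I. \<phi> i ` X)"
    and p_pos: "\<And>i. i \<in> I \<Longrightarrow> 0 < p i" and p_sum: "(\<Sum>i\<in>I. p i) = 1"
    and prob_\<mu>: "prob_space \<mu>" and sets_\<mu>: "sets \<mu> = sets borel"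
    and self_similar: "\<And>A. A \<in> sets borel \<Longrightarrow> measure \<mu> A = (\<Sum>i\<in>I. p i * measure \<mu> (\<phi> i -` A))"
    and support_\<mu>: "measure_support \<mu> = X"
begin

sublocale prob_space \<mu> by (rule prob_\<mu>)

abbreviation weight :: "'i list \<Rightarrow> real" where "weight w \<equiv> prod_list (map p w)"

lemma weight_pos: "set w \<subseteq> I \<Longrightarrow> 0 < weight w"
  using p_pos by (induction w) auto

lemma I_ne: "I \<noteq> {}"
  using p_sum by auto

lemma X_subset_level: "X \<subseteq> level n"
proof (induction n)
  case (Suc n)
  show ?case
  proof
    fix x assume "x \<in> X"
    then obtain i y where i: "i \<in> I" "y \<in> X" "x = \<phi> i y" using X_eq by blast
    then obtain w where w: "w \<in> words I n" "y \<in> comp w ` X"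
      using Suc by (auto simp: level_def)
    then have "i # w \<in> words I (Suc n)" "x \<in> comp (i # w) ` X"
      using i by (auto simp: words_def)
    then show "x \<in> level (Suc n)" unfolding level_def by blast
  qed
qed (simp add: level_def)

lemma word_of_point:
  assumes "x \<in> X"
  obtains w where "set w \<subseteq> I" "length w = n" "x \<in> comp w ` X"
  using X_subset_level[of n] assms by (auto simp: level_def words_def)

section \<open>Masses of cylinders and of the complement of the support\<close>

lemma vimage_comp_borel:
  assumes "set w \<subseteq> I" "A \<in> sets borel"
  shows "comp w -` A \<in> sets borel"
proof -
  have "comp w \<in> borel_measurable borel"
    using continuous_comp[OF assms(1)] by (rule borel_measurable_continuous_onI)
  from measurable_sets[OF this assms(2)] show ?thesis by simp
qed

lemma measure_eq_sum_words:
  "A \<in> sets borel \<Longrightarrow> measure \<mu> A = (\<Sum>w\<in>words I n. weight w * measure \<mu> (comp w -` A))"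
proof (induction n arbitrary: A)
  case (Suc n)
  have "measure \<mu> A = (\<Sum>i\<in>I. p i * measure \<mu> (\<phi> i -` A))"
    using Suc.prems by (rule self_similar)
  also have "\<dots> = (\<Sum>i\<in>I. \<Sum>w\<in>words I n. weight (i # w) * measure \<mu> (comp (i # w) -` A))"
  proof (rule sum.cong[OF refl])
    fix i assume "i \<in> I"
    then have "\<phi> i -` A \<in> sets borel"
      using vimage_comp_borel[of "[i]" A] Suc.prems by (simp add: vimage_def)
    from Suc.IH[OF this] show "p i * measure \<mu> (\<phi> i -` A) =
        (\<Sum>w\<in>words I n. weight (i # w) * measure \<mu> (comp (i # w) -` A))"
      by (simp add: sum_distrib_left vimage_def mult_ac)
  qed
  finally show ?case by (simp only: sum_words_Suc)
qed simp

lemma weight_mult_measure_le: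
  assumes k: "set k \<subseteq> I" and A: "A \<in> sets borel"
  shows "weight k * measure \<mu> (comp k -` A) \<le> measure \<mu> A"
proof -
  have "weight k * measure \<mu> (comp k -` A)
      \<le> (\<Sum>w\<in>words I (length k). weight w * measure \<mu> (comp w -` A))"
    using k finite_I weight_pos
    by (intro member_le_sum) (auto simp: words_def finite_lists_length_eq less_imp_le)
  then show ?thesis using measure_eq_sum_words[OF A] by simp
qed

text \<open>The complement of \<open>X\<close> is covered by null open sets, and by Lindelof's
  theorem countably many of them suffice.\<close>

lemma measure_Compl_X: "measure \<mu> (- X) = 0"
proof -
  define F where "F = {V :: 'a set. open V \<and> emeasure \<mu> V = 0}"
  obtain F' where F': "F' \<subseteq> F" "countable F'" "\<Union>F' = \<Union>F"
    using Lindelof[of F] by (auto simp: F_def)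
  have "- X \<subseteq> \<Union>F"
  proof
    fix x assume "x \<in> - X"
    then have "x \<notin> measure_support \<mu>" using support_\<mu> by simp
    then obtain V where "open V" "x \<in> V" "\<not> emeasure \<mu> V > 0"
      by (auto simp: measure_support_def)
    then show "x \<in> \<Union>F" by (auto simp: F_def)
  qed
  moreover have "\<Union>F' \<in> null_sets \<mu>"
  proof -
    have "(\<Union>V\<in>F'. V) \<in> null_sets \<mu>"
      using F'(1) sets_\<mu> by (intro null_sets_UN' F'(2)) (auto simp: F_def null_sets_def)
    then show ?thesis by simp
  qed
  moreover have "- X \<in> sets \<mu>"
    using compact_imp_closed[OF compact_X] sets_\<mu> by (auto simp: open_Compl)
  ultimately have "- X \<in> null_sets \<mu>" using F'(3) by (metis null_sets_subset)
  then show ?thesis by (simp add: measure_eq_0_null_sets)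
qed

lemma measure_mono: "A \<subseteq> B \<Longrightarrow> B \<in> sets borel \<Longrightarrow> measure \<mu> A \<le> measure \<mu> B"
  using sets_\<mu> by (intro finite_measure_mono) auto

lemma measure_eq_0_if_disjoint: "A \<inter> X = {} \<Longrightarrow> measure \<mu> A = 0"
  using measure_mono[of A "- X"] measure_Compl_X measure_nonneg[of \<mu> A] compact_imp_closed[OF compact_X]
  by (simp add: disjoint_eq_subset_Compl borel_open open_Compl)

lemma measure_eq_1_if_superset:
  assumes "X \<subseteq> A" "A \<in> sets borel"
  shows "measure \<mu> A = 1"
proof -
  have "space \<mu> = UNIV" using sets_eq_imp_space_eq[OF sets_\<mu>] by simp
  then have "measure \<mu> (- A) = 1 - measure \<mu> A"
    using prob_compl[of A] assms(2) sets_\<mu> by (simp add: Compl_eq_Diff_UNIV)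
  moreover have "measure \<mu> (- A) = 0" using assms(1) by (intro measure_eq_0_if_disjoint) auto
  ultimately show ?thesis by simp
qed

lemma weight_le_measure_cball:
  assumes k: "set k \<subseteq> I" "x \<in> comp k ` X" "ratio k \<le> \<rho>"
  shows "weight k \<le> measure \<mu> (cball x \<rho>)"
proof -
  have "X \<subseteq> comp k -` cball x \<rho>"
  proof
    fix y assume "y \<in> X"
    then have "dist x (comp k y) \<le> ratio k" using k by (intro dist_image_comp_le) auto
    then show "y \<in> comp k -` cball x \<rho>" using k(3) by simp
  qed
  then have "measure \<mu> (comp k -` cball x \<rho>) = 1"
    using k(1) by (intro measure_eq_1_if_superset vimage_comp_borel) auto
  then show ?thesis using weight_mult_measure_le[OF k(1), of "cball x \<rho>"] by simp
qed

section \<open>Neighbouring cylinders and isolated words\<close>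

definition neighbours :: "'i list \<Rightarrow> 'i list set" where
  "neighbours w = {v \<in> stopping_words (ratio w). \<exists>x\<in>comp w ` X. \<exists>y\<in>comp v ` X. dist x y \<le> ratio w}"

text \<open>The cylinder of a neighbour meets the ball of radius \<open>2 * ratio w\<close> about
  any point of the cylinder of \<open>w\<close>, so the bound for stopping words applies.\<close>

lemma neighbours_card_bound:
  "\<exists>M. \<forall>w. set w \<subseteq> I \<longrightarrow> finite (neighbours w) \<and> card (neighbours w) \<le> M"
proof -
  define H where "H x \<rho> = {w \<in> stopping_words \<rho>. comp w ` X \<inter> cball x (2 * \<rho>) \<noteq> {}}" for x \<rho>
  have "\<exists>M\<ge>1. \<forall>x \<rho>. finite (H x \<rho>) \<and> card (H x \<rho>) \<le> M"
    unfolding H_def by (rule stopping_words_card_bound)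
  then obtain M where M: "\<And>x \<rho>. finite (H x \<rho>)" "\<And>x \<rho>. card (H x \<rho>) \<le> M"
    by blast
  obtain z where z: "z \<in> X" using X_ne by blast
  have sub: "neighbours w \<subseteq> H (comp w z) (ratio w)" if w: "set w \<subseteq> I" for w
  proof
    fix v assume "v \<in> neighbours w"
    then obtain x y where v: "v \<in> stopping_words (ratio w)" and xy: "x \<in> comp w ` X" "y \<in> comp v ` X"
        "dist x y \<le> ratio w"
      by (auto simp: neighbours_def)
    have "dist (comp w z) x \<le> ratio w" using z xy w by (intro dist_image_comp_le) auto
    then have "y \<in> cball (comp w z) (2 * ratio w)"
      using xy(3) dist_triangle[of "comp w z" y x] by simp
    then show "v \<in> H (comp w z) (ratio w)" using v xy(2) by (auto simp: H_def)
  qed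
  show ?thesis
    using M(2) card_mono[OF M(1) sub] finite_subset[OF sub M(1)] by (meson le_trans)
qed

text \<open>\<open>comp k\<close> multiplies ratios and distances alike by \<open>ratio k\<close>.
  The inclusion can be strict, since cylinders not starting with \<open>k\<close> may come close to
  that of \<open>k @ w\<close>.\<close>

lemma append_neighbours:
  assumes "set k \<subseteq> I" "set w \<subseteq> I"
  shows "(@) k ` neighbours w \<subseteq> neighbours (k @ w)"
proof
  fix u assume "u \<in> (@) k ` neighbours w"
  then obtain v x y where v: "u = k @ v" "v \<in> stopping_words (ratio w)" "x \<in> X" "y \<in> X"
      "dist (comp w x) (comp v y) \<le> ratio w"
    by (auto simp: neighbours_def)
  have "u \<in> stopping_words (ratio (k @ w))"
    using append_stopping_words[OF assms(1) v(2)] v(1) by simp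
  moreover have "dist (comp (k @ w) x) (comp u y) \<le> ratio (k @ w)"
    using v ratio_pos[OF assms(1)] by (simp add: dist_comp[OF assms(1)])
  ultimately show "u \<in> neighbours (k @ w)"
    unfolding neighbours_def using v(3,4) by blast
qed

text \<open>Schief's trick: if \<open>w\<close> has the largest possible number of neighbours, then prefixing \<open>k\<close> cannot
  create new ones, so that near the \<open>k @ w\<close> cylinder only the mass of the \<open>k\<close> cylinder is present.\<close>

lemma isolated_word_exists:
  obtains w where "set w \<subseteq> I" "w \<noteq> []"
    "\<And>k x A. \<lbrakk>set k \<subseteq> I; x \<in> comp (k @ w) ` X; A \<in> sets borel; A \<subseteq> cball x (ratio (k @ w))\<rbrakk>
      \<Longrightarrow> measure \<mu> A = weight k * measure \<mu> (comp k -` A)"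
proof -
  obtain M where M: "\<And>w. set w \<subseteq> I \<Longrightarrow> finite (neighbours w)"
      "\<And>w. set w \<subseteq> I \<Longrightarrow> card (neighbours w) \<le> M"
    using neighbours_card_bound by auto
  obtain i where "i \<in> I" using I_ne by blast
  \<comment> \<open>The counts are bounded natural numbers, so a maximum exists. Non-empty words
    ensure \<open>ratio (k @ w) < 1\<close>, as stopping prefixes require.\<close>
  have "\<exists>w. (set w \<subseteq> I \<and> w \<noteq> []) \<and>
      (\<forall>v. set v \<subseteq> I \<and> v \<noteq> [] \<longrightarrow> card (neighbours v) \<le> card (neighbours w))"
    using \<open>i \<in> I\<close> M(2)
    by (intro ex_has_greatest_nat[where k = "[i]" and b = "Suc M"]) (auto simp: less_Suc_eq_le)
  then obtain w where w: "set w \<subseteq> I" "w \<noteq> []"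
      and max: "\<And>v. set v \<subseteq> I \<Longrightarrow> v \<noteq> [] \<Longrightarrow> card (neighbours v) \<le> card (neighbours w)"
    by blast
  show ?thesis
  proof (rule that[OF w])
    fix k x A
    assume k: "set k \<subseteq> I" and x: "x \<in> comp (k @ w) ` X" and A: "A \<in> sets borel"
      and Ax: "A \<subseteq> cball x (ratio (k @ w))"
    have kw: "set (k @ w) \<subseteq> I" "k @ w \<noteq> []" using k w by auto
    have nb: "(@) k ` neighbours w = neighbours (k @ w)"
    proof (rule card_subset_eq[OF M(1)[OF kw(1)] append_neighbours[OF k w(1)]])
      have "card ((@) k ` neighbours w) = card (neighbours w)"
        by (rule card_image) (auto simp: inj_on_def)
      then show "card ((@) k ` neighbours w) = card (neighbours (k @ w))"
        using max[OF kw] card_mono[OF M(1)[OF kw(1)] append_neighbours[OF k w(1)]] by simp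
    qed
    obtain n0 where n0: "\<And>v. set v \<subseteq> I \<Longrightarrow> n0 \<le> length v \<Longrightarrow> ratio v \<le> ratio (k @ w)"
      using ratio_small[OF ratio_pos[OF kw(1)]] by blast
    define n where "n = max n0 (length k)"
    \<comment> \<open>If the cylinder of \<open>v\<close> meets \<open>A\<close>, the stopping
      prefix of \<open>v\<close> at scale \<open>ratio (k @ w)\<close> is a neighbour of
      \<open>k @ w\<close>, so by \<open>nb\<close> the word \<open>v\<close> begins with
      \<open>k\<close>.\<close>
    have zero: "measure \<mu> (comp v -` A) = 0"
      if v: "v \<in> words I n" "v \<notin> (@) k ` words I (n - length k)" for v
    proof (rule measure_eq_0_if_disjoint, rule ccontr)
      assume "comp v -` A \<inter> X \<noteq> {}"
      then obtain a where a: "a \<in> X" "comp v a \<in> A" by blast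
      have vI: "set v \<subseteq> I" "ratio v \<le> ratio (k @ w)" using v n0 by (auto simp: words_def n_def)
      then obtain v' where v': "v' \<in> stopping_words (ratio (k @ w))" "prefix v' v"
        using prefix_stopping_words ratio_less_1[OF kw] by blast
      then obtain u where u: "v = v' @ u" by (auto simp: prefix_def)
      then have "comp v a \<in> comp v' ` X"
        using image_comp_append_subset[of u v'] a(1) vI(1) by auto
      moreover have "dist x (comp v a) \<le> ratio (k @ w)" using Ax a(2) by auto
      ultimately have "v' \<in> neighbours (k @ w)"
        unfolding neighbours_def using v'(1) x by blast
      then obtain u' where "v' = k @ u'" using nb by blast
      then have "v = k @ (u' @ u)" using u by simp
      moreover from this have "u' @ u \<in> words I (n - length k)" using v(1) by (auto simp: words_def)
      ultimately show False using v(2) by blast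
    qed
    have "measure \<mu> A = (\<Sum>v\<in>words I n. weight v * measure \<mu> (comp v -` A))"
      by (rule measure_eq_sum_words[OF A])
    also have "\<dots> = (\<Sum>v\<in>(@) k ` words I (n - length k). weight v * measure \<mu> (comp v -` A))"
      using k zero finite_words[OF finite_I]
      by (intro sum.mono_neutral_right) (auto simp: words_def n_def)
    also have "\<dots> = (\<Sum>u\<in>words I (n - length k). weight k * (weight u * measure \<mu> (comp u -` (comp k -` A))))"
      by (subst sum.reindex) (auto simp: inj_on_def vimage_def mult_ac)
    also have "\<dots> = weight k * measure \<mu> (comp k -` A)"
      using measure_eq_sum_words[OF vimage_comp_borel[OF k A]] by (simp flip: sum_distrib_left)
    finally show "measure \<mu> A = weight k * measure \<mu> (comp k -` A)" .
  qed
qed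

section \<open>Nullity of the set of doubling points\<close>

text \<open>Codings of points of \<open>A\<close> in blocks of the length of \<open>u\<close> never
  use the block \<open>u\<close>. The remaining blocks form a system whose ratios to the power
  \<open>t\<close> sum to \<open>1 - ratio u powr t\<close>.\<close>

lemma avoiding_word_null:
  assumes t: "0 < t" "(\<Sum>i\<in>I. r i powr t) = 1" and u: "set u \<subseteq> I" and A: "A \<subseteq> X"
    and avoid: "\<And>k. set k \<subseteq> I \<Longrightarrow> A \<inter> comp (k @ u) ` X = {}"
  shows "hausdorff_measure t A = 0"
proof -
  define J where "J = words I (length u) - {u}"
  have J: "J \<subseteq> words I (length u)" "[] \<notin> J" by (auto simp: J_def words_def)
  interpret B: contractive_system J ratio comp X by (rule contractive_system_blocks[OF J])
  have "\<exists>V\<in>words J n. x \<in> comp (concat V) ` X" if x: "x \<in> A" for x n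
  proof (induction n)
    case 0
    then show ?case using x A by auto
  next
    case (Suc n)
    then obtain V y where V: "V \<in> words J n" "y \<in> X" "x = comp (concat V) y" by blast
    obtain v where v: "set v \<subseteq> I" "length v = length u" "y \<in> comp v ` X"
      using word_of_point[OF V(2)] by metis
    have x': "x \<in> comp (concat V @ v) ` X" using V(3) v(3) by auto
    have "set (concat V) \<subseteq> I" using V(1) J(1) by (auto simp: words_def)
    \<comment> \<open>The blocks found so far act as the prefix \<open>k\<close> in
      \<open>avoid\<close>.\<close>
    then have "v \<noteq> u" using avoid x x' by blast
    then have "V @ [v] \<in> words J (Suc n)" using V(1) v by (auto simp: words_def J_def)
    moreover have "x \<in> comp (concat (V @ [v])) ` X" using x' by simp
    ultimately show ?case by blast
  qed
  then have "A \<subseteq> B.level n" for n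
    unfolding B.level_def by (fastforce simp: foldr_foldr)
  moreover have "(\<Sum>w\<in>J. ratio w powr t) < 1"
  proof -
    have eq: "ratio w powr t = prod_list (map (\<lambda>i. r i powr t) w)" if "set w \<subseteq> I" for w
      using that r_pos by (intro prod_list_map_powr[symmetric]) auto
    have "(\<Sum>w\<in>words I (length u). ratio w powr t) = (\<Sum>i\<in>I. r i powr t) ^ length u"
      by (subst sum_words_prod_list[symmetric]) (auto simp: words_def eq intro!: sum.cong)
    then have "(\<Sum>w\<in>words I (length u). ratio w powr t) = 1" using t(2) by simp
    moreover have "(\<Sum>w\<in>words I (length u). ratio w powr t) = ratio u powr t + (\<Sum>w\<in>J. ratio w powr t)"
      unfolding J_def using u by (intro sum.remove finite_words finite_I) (auto simp: words_def)
    moreover have "0 < ratio u powr t" using ratio_pos[OF u] by simp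
    ultimately show ?thesis by linarith
  qed
  ultimately show ?thesis
    using t(1) by (intro B.hausdorff_measure_Inter_level_null)
qed

lemma doubling_iterate:
  assumes "\<And>\<rho>. 0 < \<rho> \<Longrightarrow> measure \<mu> (cball y (2 * \<rho>)) \<le> C * measure \<mu> (cball y \<rho>)"
    and "0 \<le> C" "0 < R"
  shows "measure \<mu> (cball y (2 ^ n * R)) \<le> C ^ n * measure \<mu> (cball y R)"
proof (induction n)
  case (Suc n)
  have "measure \<mu> (cball y (2 ^ Suc n * R)) \<le> C * measure \<mu> (cball y (2 ^ n * R))"
    using assms(1)[of "2 ^ n * R"] \<open>0 < R\<close> by (simp add: mult.assoc)
  also have "\<dots> \<le> C * (C ^ n * measure \<mu> (cball y R))"
    using Suc \<open>0 \<le> C\<close> by (rule mult_left_mono)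
  finally show ?case by (simp add: mult.assoc)
qed simp

lemma doubling_points_null:
  assumes t: "0 < t" "(\<Sum>i\<in>I. r i powr t) = 1" and nd: "\<not> doubling_measure_on X \<mu>"
  shows "hausdorff_measure t (doubling_points \<mu>) = 0"
proof -
  obtain w where w: "set w \<subseteq> I" "w \<noteq> []" and
    iso: "\<And>k x A. \<lbrakk>set k \<subseteq> I; x \<in> comp (k @ w) ` X; A \<in> sets borel; A \<subseteq> cball x (ratio (k @ w))\<rbrakk>
      \<Longrightarrow> measure \<mu> A = weight k * measure \<mu> (comp k -` A)"
    by (rule isolated_word_exists) (rule that)
  obtain b where b: "0 < b" "b \<le> 1" "\<And>w. set w \<subseteq> I \<Longrightarrow> b ^ length w \<le> ratio w"
    using ratio_lower_bound by auto
  have bw: "0 < b * ratio w / 6" using b ratio_pos[OF w(1)] by simp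
  \<comment> \<open>\<open>q\<close> doublings will carry the radius
    \<open>ratio (k @ a @ w)\<close> to at least \<open>ratio k * (3 * \<rho>)\<close>: since
    \<open>ratio a \<ge> b * (\<rho> / 2)\<close>, the quotient of the two radii is at most
    \<open>6 / (b * ratio w)\<close>, whatever \<open>\<rho>\<close>, \<open>a\<close> and
    \<open>k\<close> are.\<close>
  obtain q where q: "6 / (b * ratio w) < 2 ^ q" using real_arch_pow[of 2 "6 / (b * ratio w)"] by auto
  define D where "D C = {y \<in> X. \<forall>\<rho>>0. measure \<mu> (cball y (2 * \<rho>)) \<le> C * measure \<mu> (cball y \<rho>)}" for C
  have null: "hausdorff_measure t (D C') = 0" if C': "0 \<le> C'" for C'
  proof -
    \<comment> \<open>\<open>C' ^ q\<close> is what a point of \<open>D C'\<close> loses in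
      \<open>q\<close> doublings. \<open>1 \<le> C\<close> forces the bad radius below 1, since a
      ball of radius 1 about a point of \<open>X\<close> has full mass.\<close>
    define C where "C = max 1 (C' ^ q)"
    have C: "1 \<le> C" "C' ^ q \<le> C" by (auto simp: C_def)
    then obtain x \<rho> where x: "x \<in> X" and \<rho>: "0 < \<rho>"
        and big: "measure \<mu> (cball x (2 * \<rho>)) > C * measure \<mu> (cball x \<rho>)"
      using nd unfolding doubling_measure_on_def by (metis less_le_trans not_le zero_less_one)
    have "\<rho> < 1"
    proof (rule ccontr)
      assume "\<not> \<rho> < 1"
      have "X \<subseteq> cball x \<rho>"
      proof
        fix y assume "y \<in> X"
        from dist_X_le[OF x this] show "y \<in> cball x \<rho>" using \<open>\<not> \<rho> < 1\<close> by simp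
      qed
      then have "measure \<mu> (cball x \<rho>) = 1" by (rule measure_eq_1_if_superset) auto
      then show False using big C(1) prob_le_1[of "cball x (2 * \<rho>)"] by simp
    qed
    obtain n where n: "\<And>w. set w \<subseteq> I \<Longrightarrow> n \<le> length w \<Longrightarrow> ratio w \<le> \<rho> / 2"
      using ratio_small[of "\<rho> / 2"] \<rho> by auto
    obtain v where v: "set v \<subseteq> I" "length v = n" "x \<in> comp v ` X"
      using word_of_point[OF x] by metis
    then obtain a where a: "a \<in> stopping_words (\<rho> / 2)" "prefix a v"
      using prefix_stopping_words[of v "\<rho> / 2"] n[of v] \<open>\<rho> < 1\<close> by auto
    then have aI: "set a \<subseteq> I" "ratio a \<le> \<rho> / 2" by (auto simp: stopping_words_def)
    obtain a' where "v = a @ a'" using a(2) by (auto simp: prefix_def)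
    then have xa: "x \<in> comp a ` X" using image_comp_append_subset[of a' a] v by auto
    have ba: "b * (\<rho> / 2) \<le> ratio a"
    proof -
      obtain a0 i where a0: "a = a0 @ [i]" using a(1)
        by (cases a rule: rev_cases) (auto simp: stopping_words_def)
      have "(\<rho> / 2) * b \<le> ratio a0 * r i"
        using a(1) a0 b(1) b(3)[of "[i]"] \<rho> by (intro mult_mono) (auto simp: stopping_words_def)
      then show ?thesis using a0 by (simp add: mult_ac)
    qed
    have "D C' \<inter> comp (k @ (a @ w)) ` X = {}" if k: "set k \<subseteq> I" for k
    proof (rule ccontr)
      assume "\<not> ?thesis"
      then obtain y z where y: "y \<in> D C'" "z \<in> X" "y = comp k (comp (a @ w) z)" by auto
      define y' where "y' = comp (a @ w) z"
      define R where "R = ratio (k @ a @ w)"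
      have R: "R = ratio k * ratio (a @ w)" "0 < R"
        using ratio_pos[OF k] ratio_pos[OF aI(1)] ratio_pos[OF w(1)] by (auto simp: R_def)
      have "y' \<in> comp a ` X"
        unfolding y'_def using image_comp_append_subset[OF w(1), of a] y(2) by auto
      then have xy': "dist x y' \<le> \<rho> / 2"
        using dist_image_comp_le[OF aI(1) xa] aI(2) by fastforce
      have ky: "comp k -` cball y (ratio k * \<sigma>) = cball y' \<sigma>" for \<sigma>
        unfolding y(3) y'_def using vimage_comp_cball[OF k] by simp
      have "ratio (a @ w) \<le> \<rho> / 2"
        using aI(2) ratio_le_1[OF w(1)] ratio_pos[OF aI(1)] mult_left_le[of "ratio w" "ratio a"]
        unfolding map_append prod_list.append by linarith
      then have sub1: "cball y' (ratio (a @ w)) \<subseteq> cball x \<rho>"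
        using xy' by (auto simp: cball_subset_cball_iff dist_commute)
      \<comment> \<open>Upper bound at the small radius. Isolation applies to the prefix
        \<open>k @ a\<close>; dropping \<open>a\<close> by \<open>weight_mult_measure_le\<close>
        leaves the copy of \<open>\<mu>\<close> under \<open>k\<close>, where the preimage of the
        ball lies in \<open>cball x \<rho>\<close>.\<close>
      have "measure \<mu> (cball y R) = weight (k @ a) * measure \<mu> (comp (k @ a) -` cball y R)"
        using k aI y by (intro iso) (auto simp: R_def)
      also have "\<dots> = weight k * (weight a * measure \<mu> (comp a -` (comp k -` cball y R)))"
        by (simp add: vimage_def)
      also have "\<dots> \<le> weight k * measure \<mu> (comp k -` cball y R)"
        using weight_pos[OF k] vimage_comp_borel[OF k]
        by (intro mult_left_mono weight_mult_measure_le aI) auto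
      also have "\<dots> \<le> weight k * measure \<mu> (cball x \<rho>)"
        unfolding R(1) ky using weight_pos[OF k] sub1 by (intro mult_left_mono measure_mono) auto
      finally have up: "measure \<mu> (cball y R) \<le> weight k * measure \<mu> (cball x \<rho>)" .
      have sub2: "cball x (2 * \<rho>) \<subseteq> cball y' (3 * \<rho>)"
        using xy' \<rho> by (auto simp: cball_subset_cball_iff)
      have "3 * \<rho> \<le> 2 ^ q * ratio (a @ w)"
      proof -
        have "6 < 2 ^ q * (b * ratio w)" using q bw by (simp add: field_simps)
        then have "6 * (\<rho> / 2) \<le> 2 ^ q * (b * ratio w) * (\<rho> / 2)"
          using \<rho> by (intro mult_right_mono) auto
        also have "\<dots> = 2 ^ q * ratio w * (b * (\<rho> / 2))" by simp
        also have "\<dots> \<le> 2 ^ q * ratio w * ratio a"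
          using ba ratio_pos[OF w(1)] by (intro mult_left_mono) auto
        finally show ?thesis by (simp add: mult_ac)
      qed
      then have "ratio k * (3 * \<rho>) \<le> 2 ^ q * R"
        using mult_left_mono[of "3 * \<rho>" "2 ^ q * ratio (a @ w)" "ratio k"] ratio_pos[OF k] R(1)
        by (simp add: mult_ac)
      then have sub3: "cball y (ratio k * (3 * \<rho>)) \<subseteq> cball y (2 ^ q * R)" by auto
      \<comment> \<open>Lower bound at the large radius, where \<open>weight_mult_measure_le\<close>
        suffices without isolation; \<open>q\<close> doublings then lead back to
        \<open>R\<close>.\<close>
      have "weight k * measure \<mu> (cball x (2 * \<rho>)) \<le> weight k * measure \<mu> (cball y' (3 * \<rho>))"
        using weight_pos[OF k] sub2 by (intro mult_left_mono measure_mono) auto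
      also have "\<dots> \<le> measure \<mu> (cball y (ratio k * (3 * \<rho>)))"
        unfolding ky[symmetric] using k by (intro weight_mult_measure_le) auto
      also have "\<dots> \<le> measure \<mu> (cball y (2 ^ q * R))"
        using sub3 by (intro measure_mono) auto
      also have "\<dots> \<le> C' ^ q * measure \<mu> (cball y R)"
        using y(1) C' R(2) by (intro doubling_iterate) (auto simp: D_def)
      also have "\<dots> \<le> C * (weight k * measure \<mu> (cball x \<rho>))"
        using C up by (intro mult_mono) auto
      finally have "weight k * measure \<mu> (cball x (2 * \<rho>)) \<le> weight k * (C * measure \<mu> (cball x \<rho>))"
        by (simp add: mult_ac)
      then show False using big weight_pos[OF k] by simp
    qed
    then show ?thesis
      using t w(1) aI(1) by (intro avoiding_word_null[of t "a @ w"]) (auto simp: D_def)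
  qed
  have "doubling_points \<mu> \<subseteq> (\<Union>n. D (real n))"
  proof
    fix y assume "y \<in> doubling_points \<mu>"
    then obtain C where y: "y \<in> X" and C: "C > 0"
        "\<And>\<rho>. 0 < \<rho> \<Longrightarrow> measure \<mu> (cball y (2 * \<rho>)) \<le> C * measure \<mu> (cball y \<rho>)"
      using support_\<mu> by (auto simp: doubling_points_def doubling_at_def)
    obtain n where "C \<le> real n" using real_arch_simple by blast
    then have "C * measure \<mu> (cball y \<rho>) \<le> real n * measure \<mu> (cball y \<rho>)" for \<rho>
      by (intro mult_right_mono) auto
    then have "y \<in> D (real n)" using y C(2) by (auto simp: D_def intro: order_trans)
    then show "y \<in> (\<Union>n. D (real n))" by blast
  qed
  then have "hausdorff_measure t (doubling_points \<mu>) \<le> hausdorff_measure t (\<Union>n. D (real n))"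
    by (rule hausdorff_measure_mono)
  also have "\<dots> = 0" using null by (intro hausdorff_measure_UN_null) auto
  finally show ?thesis by simp
qed


section \<open>Doubling points coded by blocks ending in an isolated word\<close>

text \<open>Given a small radius \<open>\<rho>\<close>, stop at the block before the ratio drops
  below \<open>2 * \<rho>\<close>. The word so far is some \<open>k @ w\<close>, so isolation bounds
  the mass of the large ball by \<open>weight k\<close>, while boundedly many more letters give a
  cylinder inside the small ball with mass at least a fixed multiple of
  \<open>weight k\<close>.\<close>

lemma limit_set_blocks_doubling:
  assumes w: "set w \<subseteq> I" "w \<noteq> []" and
    iso: "\<And>k x A. \<lbrakk>set k \<subseteq> I; x \<in> comp (k @ w) ` X; A \<in> sets borel; A \<subseteq> cball x (ratio (k @ w))\<rbrakk>
      \<Longrightarrow> measure \<mu> A = weight k * measure \<mu> (comp k -` A)"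
    and x: "\<And>n. \<exists>V\<in>words ((\<lambda>b. b @ w) ` words I N) n. x \<in> comp (concat V) ` X"
  shows "doubling_at \<mu> x"
proof -
  define l where "l = N + length w"
  define J where "J = (\<lambda>b. b @ w) ` words I N"
  have J: "set v \<subseteq> I \<and> length v = l" if "v \<in> J" for v
    using that w(1) by (auto simp: J_def l_def words_def)
  have JV: "set (concat V) \<subseteq> I \<and> length (concat V) = n * l" if "V \<in> words J n" for V n
    using that
  proof (induction V arbitrary: n)
    case (Cons v V)
    then have "v \<in> J" "V \<in> words J (n - 1)" "n = Suc (n - 1)" by (auto simp: words_def)
    then show ?case using Cons.IH[of "n - 1"] J[of v] by (cases n) auto
  qed (simp add: words_def)
  obtain b where b: "0 < b" "b \<le> 1" "\<And>v. set v \<subseteq> I \<Longrightarrow> b ^ length v \<le> ratio v"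
    using ratio_lower_bound by auto
  obtain q where q: "0 < q" "q \<le> 1" "\<And>v. set v \<subseteq> I \<Longrightarrow> q ^ length v \<le> weight v"
    using prod_list_lower_bound[OF finite_I, of p] p_pos by auto
  define B where "B = b ^ l"
  have B: "0 < B" "B \<le> 1" using b by (auto simp: B_def power_le_one)
  \<comment> \<open>\<open>B\<close> bounds the ratio of a block from below. Appending
    \<open>L\<close> letters turns \<open>ratio h * B \<le> 2 * \<rho>\<close> into a ratio of at
    most \<open>\<rho>\<close>.\<close>
  obtain L where L: "\<And>v. set v \<subseteq> I \<Longrightarrow> L \<le> length v \<Longrightarrow> ratio v \<le> B / 2"
    using ratio_small[of "B / 2"] B by auto
  \<comment> \<open>The first summand serves the radii with \<open>2 * \<rho> < B\<close>, the
    second the larger ones.\<close>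
  define K where "K = 1 / (weight w * q ^ L) + 1 / q ^ L"
  have ww: "0 < weight w" using weight_pos[OF w(1)] .
  have K: "0 < K" "1 \<le> K * q ^ L" "1 \<le> K * (weight w * q ^ L)"
    using ww q by (auto simp: K_def field_simps intro!: add_pos_pos)
  have lower: "weight h * q ^ L \<le> measure \<mu> (cball x \<rho>)"
    if h: "set h \<subseteq> I" "x \<in> comp h ` X" "ratio h * B \<le> 2 * \<rho>" for h \<rho>
  proof -
    obtain y where y: "y \<in> X" "x = comp h y" using h(2) by blast
    obtain e where e: "set e \<subseteq> I" "length e = L" "y \<in> comp e ` X"
      using word_of_point[OF y(1)] by metis
    have "ratio h * ratio e \<le> ratio h * (B / 2)"
      using L[of e] e ratio_pos[OF h(1)] by (intro mult_left_mono) auto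
    then have "ratio (h @ e) \<le> \<rho>" using h(3) by simp
    then have "weight (h @ e) \<le> measure \<mu> (cball x \<rho>)"
      using h(1) e y(2) by (intro weight_le_measure_cball) auto
    moreover have "weight h * q ^ L \<le> weight h * weight e"
      using q(3)[OF e(1)] e(2) weight_pos[OF h(1)] by (intro mult_left_mono) auto
    ultimately show ?thesis by simp
  qed
  have "measure \<mu> (cball x (2 * \<rho>)) \<le> K * measure \<mu> (cball x \<rho>)" if \<rho>: "0 < \<rho>" for \<rho>
  proof (cases "B \<le> 2 * \<rho>")
    case True
    have "x \<in> X" using x[of 0] by auto
    then have "q ^ L \<le> measure \<mu> (cball x \<rho>)" using lower[of "[]" \<rho>] True by simp
    then have "K * q ^ L \<le> K * measure \<mu> (cball x \<rho>)" using K(1) by (intro mult_left_mono) auto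
    then show ?thesis using K(2) prob_le_1[of "cball x (2 * \<rho>)"] by linarith
  next
    case False
    \<comment> \<open>Codings of \<open>x\<close> by different numbers of blocks need not extend one
      another, so the least \<open>n\<close> is taken over all codings; minimality is then applied
      to \<open>V\<close> without its last block.\<close>
    define Q where "Q n \<longleftrightarrow> (\<exists>V\<in>words J n. x \<in> comp (concat V) ` X \<and> ratio (concat V) < 2 * \<rho>)" for n
    obtain n0 where n0: "\<And>v. set v \<subseteq> I \<Longrightarrow> n0 \<le> length v \<Longrightarrow> ratio v \<le> \<rho>"
      using ratio_small[OF \<rho>] by blast
    have "Q n0"
    proof -
      obtain V where V: "V \<in> words J n0" "x \<in> comp (concat V) ` X" using x[of n0] by (auto simp: J_def)
      have "1 \<le> l" using w(2) by (cases w) (auto simp: l_def)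
      then have "n0 \<le> n0 * l" by simp
      then have "ratio (concat V) \<le> \<rho>" using n0[of "concat V"] JV[OF V(1)] by simp
      then show ?thesis unfolding Q_def using V \<rho> by force
    qed
    define n where "n = (LEAST n. Q n)"
    have "Q n" unfolding n_def using \<open>Q n0\<close> by (rule LeastI)
    then obtain V where V: "V \<in> words J n" "x \<in> comp (concat V) ` X" "ratio (concat V) < 2 * \<rho>"
      by (auto simp: Q_def)
    have "V \<noteq> []" using V(3) False B by auto
    then obtain V' v where V': "V = V' @ [v]" by (cases V rule: rev_cases) auto
    then have v: "v \<in> J" "V' \<in> words J (n - 1)" "n - 1 < n" using V(1) by (auto simp: words_def)
    have "B \<le> ratio v" using b(3)[of v] J[OF v(1)] by (auto simp: B_def)
    have xV': "x \<in> comp (concat V') ` X"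
      using image_comp_append_subset[of v "concat V'"] J[OF v(1)] V(2) V' by auto
    have "\<not> Q (n - 1)" using v(3) unfolding n_def by (rule not_less_Least)
    then have big: "2 * \<rho> \<le> ratio (concat V')" using v(2) xV' by (auto simp: Q_def not_less)
    \<comment> \<open>Otherwise \<open>V\<close> would be a single block, of ratio at least
      \<open>B > 2 * \<rho>\<close>.\<close>
    have "V' \<noteq> []" using V(3) V' \<open>B \<le> ratio v\<close> False by auto
    then obtain V'' v' where V'': "V' = V'' @ [v']" by (cases V' rule: rev_cases) auto
    then obtain b' where b': "v' = b' @ w" using v(2) by (auto simp: words_def J_def)
    define k where "k = concat V'' @ b'"
    have kw: "concat V' = k @ w" by (simp add: V'' b' k_def)
    then have kI: "set k \<subseteq> I" using JV[OF v(2)] by simp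
    have "measure \<mu> (cball x (2 * \<rho>)) = weight k * measure \<mu> (comp k -` cball x (2 * \<rho>))"
      using kI xV' big by (intro iso) (auto simp: kw)
    also have "\<dots> \<le> weight k" using weight_pos[OF kI] by (intro mult_left_le) auto
    finally have up: "measure \<mu> (cball x (2 * \<rho>)) \<le> weight k" .
    have "ratio (concat V') * B \<le> ratio (concat V') * ratio v"
      using \<open>B \<le> ratio v\<close> big \<rho> by (intro mult_left_mono) auto
    also have "\<dots> \<le> 2 * \<rho>" using V(3) V' by simp
    finally have "weight (concat V') * q ^ L \<le> measure \<mu> (cball x \<rho>)"
      using JV[OF v(2)] xV' by (intro lower) auto
    then have "K * (weight k * (weight w * q ^ L)) \<le> K * measure \<mu> (cball x \<rho>)"
      using K(1) by (intro mult_left_mono) (auto simp: kw mult_ac)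
    moreover have "weight k * 1 \<le> weight k * (K * (weight w * q ^ L))"
      using K(3) weight_pos[OF kI] by (intro mult_left_mono) auto
    ultimately show ?thesis using up by (simp add: mult_ac)
  qed
  then show ?thesis unfolding doubling_at_def using K(1) by blast
qed

lemma hausdorff_measure_doubling_points_pos:
  assumes t: "(\<Sum>i\<in>I. r i powr t) = 1" and s: "0 < s" "s < t"
  shows "hausdorff_measure s (doubling_points \<mu>) \<noteq> 0"
proof -
  obtain w where w: "set w \<subseteq> I" "w \<noteq> []" and
    iso: "\<And>k x A. \<lbrakk>set k \<subseteq> I; x \<in> comp (k @ w) ` X; A \<in> sets borel; A \<subseteq> cball x (ratio (k @ w))\<rbrakk>
      \<Longrightarrow> measure \<mu> A = weight k * measure \<mu> (comp k -` A)"
    by (rule isolated_word_exists) (rule that)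
  define g where "g = (\<Sum>i\<in>I. r i powr s)"
  have "1 < g" using powr_sum_strict_antimono[OF I_ne s(2)] t by (simp add: g_def)
  have rw: "0 < ratio w powr s" using ratio_pos[OF w(1)] by simp
  \<comment> \<open>Since \<open>g > 1\<close>, enough free letters outweigh the fixed factor
    \<open>ratio w powr s\<close> lost to the appended \<open>w\<close>, and the sum over the blocks
    reaches 1.\<close>
  obtain N where N: "1 / ratio w powr s < g ^ N" using real_arch_pow[OF \<open>1 < g\<close>] by blast
  define J where "J = (\<lambda>b. b @ w) ` words I N"
  have J: "J \<subseteq> words I (N + length w)" "[] \<notin> J" using w by (auto simp: J_def words_def)
  interpret B: osc_system J ratio comp X U by (rule osc_system_blocks[OF J])
  have "(\<Sum>v\<in>J. ratio v powr s) = (\<Sum>b\<in>words I N. ratio (b @ w) powr s)"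
    unfolding J_def by (subst sum.reindex) (auto simp: inj_on_def)
  also have "\<dots> = (\<Sum>b\<in>words I N. prod_list (map (\<lambda>i. r i powr s) b) * ratio w powr s)"
  proof (rule sum.cong[OF refl])
    fix b assume "b \<in> words I N"
    then have "set b \<subseteq> I" by (simp add: words_def)
    then show "ratio (b @ w) powr s = prod_list (map (\<lambda>i. r i powr s) b) * ratio w powr s"
      using ratio_pos[of b] ratio_pos[OF w(1)] r_pos
      by (subst prod_list_map_powr) (auto simp: powr_mult)
  qed
  also have "\<dots> = g ^ N * ratio w powr s"
    by (simp add: g_def sum_words_prod_list flip: sum_distrib_right)
  finally have "1 \<le> (\<Sum>v\<in>J. ratio v powr s)" using N rw by (simp add: field_simps)
  then have "hausdorff_measure s (\<Inter>n. B.level n) \<noteq> 0"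
    using s(1) by (intro B.hausdorff_measure_Inter_level_pos)
  moreover have "(\<Inter>n. B.level n) \<subseteq> doubling_points \<mu>"
  proof
    fix x assume "x \<in> (\<Inter>n. B.level n)"
    then have *: "\<exists>V\<in>words J n. x \<in> comp (concat V) ` X" for n
      unfolding B.level_def by (fastforce simp: foldr_foldr)
    have "doubling_at \<mu> x"
      using w iso * unfolding J_def by (rule limit_set_blocks_doubling)
    moreover have "x \<in> X" using *[of 0] by auto
    ultimately show "x \<in> doubling_points \<mu>" using support_\<mu> by (simp add: doubling_points_def)
  qed
  ultimately show ?thesis
    using hausdorff_measure_mono[of "\<Inter>n. B.level n" "doubling_points \<mu>" s] by auto
qed

section \<open>The Hausdorff dimension\<close>

text \<open>A general \<open>A\<close> allows use for both the doubling points and \<open>X\<close>.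
  The infimum in \<open>hausdorff_dim\<close> runs over all exponents of measure zero, so each
  \<open>s < t\<close> is excluded directly, without comparing different exponents.\<close>

lemma hausdorff_dim_eq:
  assumes t: "0 < t" "(\<Sum>i\<in>I. r i powr t) = 1" and A: "doubling_points \<mu> \<subseteq> A"
    and null: "\<And>s. t < s \<Longrightarrow> hausdorff_measure s A = 0"
  shows "hausdorff_dim A = ennreal t"
proof (rule antisym)
  show "hausdorff_dim A \<le> ennreal t"
  proof (rule ennreal_le_epsilon)
    fix e :: real assume "0 < e"
    then have "hausdorff_dim A \<le> ennreal (t + e)"
      unfolding hausdorff_dim_def using t(1) null[of "t + e"]
      by (intro Inf_lower) (auto intro!: exI[of _ "t + e"] simp del: ennreal_plus)
    then show "hausdorff_dim A \<le> ennreal t + ennreal e" using t(1) \<open>0 < e\<close> by simp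
  qed
  have pos: "t \<le> s" if "0 \<le> s" "hausdorff_measure s A = 0" for s
  proof (rule ccontr)
    assume "\<not> t \<le> s"
    have le: "hausdorff_measure u (doubling_points \<mu>) \<le> hausdorff_measure u A" for u
      using A by (rule hausdorff_measure_mono)
    show False
    proof (cases "s = 0")
      case True
      \<comment> \<open>Positivity is available for positive exponents; at exponent 0 a null set is
        empty, which contradicts positivity at \<open>t / 2\<close>.\<close>
      have "doubling_points \<mu> = {}"
        using le[of 0] that(2) True by (intro hausdorff_measure_0_eq_0_imp_empty) simp
      then show False
        using hausdorff_measure_doubling_points_pos[OF t(2), of "t / 2"] t(1) by simp
    next
      case False
      then show False
        using hausdorff_measure_doubling_points_pos[OF t(2), of s] le[of s] that \<open>\<not> t \<le> s\<close> by simp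
    qed
  qed
  show "ennreal t \<le> hausdorff_dim A"
    unfolding hausdorff_dim_def by (rule Inf_greatest) (auto intro!: ennreal_leI pos)
qed

end

section \<open>Dimension and measure of the doubling points of the given system\<close>

theorem theorem1p1:
  fixes m :: nat
    and r :: "nat \<Rightarrow> real"
    and \<phi> :: "nat \<Rightarrow> 'a::euclidean_space \<Rightarrow> 'a"
    and X :: "'a set"
    and p :: "nat \<Rightarrow> real"
    and \<mu> :: "'a measure"
    and s :: real
  assumes "self_similar_ifs m r \<phi>"
    and "self_similar_set m \<phi> X"
    and "diameter X = 1"
    and "open_set_condition m \<phi>"
    and "s = enn2real (hausdorff_dim X)"
    and "positive_probability_vector m p"
    and "self_similar_measure m \<phi> p \<mu>"
    and "measure_support \<mu> = X"
    and "\<not> doubling_measure_on X \<mu>"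
  shows "hausdorff_dim (doubling_points \<mu>) = ennreal s
       \<and> hausdorff_measure s (doubling_points \<mu>) = 0"
proof -
  have sim: "contractive_similarity (r i) (\<phi> i)" if "i \<in> {1..m}" for i
    using assms(1) that by (simp add: self_similar_ifs_def)
  have X: "X \<noteq> {}" "compact X" and X_eq: "X = (\<Union>i\<in>{1..m}. \<phi> i ` X)"
    using assms(2) unfolding self_similar_set_def by blast+
  have dist: "dist x y \<le> 1" if "x \<in> X" "y \<in> X" for x y
    using diameter_bounded_bound[OF compact_imp_bounded[OF X(2)] that] assms(3) by simp
  obtain U where U: "U \<noteq> {}" "bounded U" "open U" "\<forall>i\<in>{1..m}. \<phi> i ` U \<subseteq> U"
      "\<forall>i\<in>{1..m}. \<forall>j\<in>{1..m}. i \<noteq> j \<longrightarrow> \<phi> i ` U \<inter> \<phi> j ` U = {}"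
    using assms(4) unfolding open_set_condition_def by blast
  interpret self_similar_system "{1..m}" r \<phi> X U p \<mu>
  proof (intro self_similar_system.intro osc_system.intro contractive_system.intro
      osc_system_axioms.intro self_similar_system_axioms.intro)
    show "\<phi> i ` X \<subseteq> X" if "i \<in> {1..m}" for i using X_eq that by blast
    show "X = (\<Union>i\<in>{1..m}. \<phi> i ` X)" by (rule X_eq)
    show "0 < p i" if "i \<in> {1..m}" for i
      using assms(6) that by (simp add: positive_probability_vector_def)
    show "(\<Sum>i\<in>{1..m}. p i) = 1" using assms(6) by (simp add: positive_probability_vector_def)
  qed (use sim X dist U assms(7,8) in \<open>auto simp: self_similar_measure_def\<close>)
  \<comment> \<open>With a single map \<open>X\<close> would equal its own contracted image, which
    has diameter below 1.\<close>
  have "2 \<le> card {1..m}"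
  proof (rule ccontr)
    assume "\<not> 2 \<le> card {1..m}"
    moreover have "m \<noteq> 0" using I_ne by auto
    ultimately have m: "{1..m} = {1}" by auto
    have "X = (\<Union>i\<in>{1}. \<phi> i ` X)" using X_eq unfolding m .
    also have "\<dots> = \<phi> 1 ` X" by simp
    finally have X1: "\<phi> 1 ` X = X" by (rule sym)
    have one: "1 \<in> {1..m}" unfolding m by simp
    have "diameter (\<phi> 1 ` X) \<le> r 1" using diameter_image_comp_le[of "[1]"] one by simp
    then have "diameter X \<le> r 1" unfolding X1 .
    then show False using assms(3) r_less_1[OF one] by simp
  qed
  then obtain t where t: "0 < t" "(\<Sum>i\<in>{1..m}. r i powr t) = 1"
    by (rule similarity_dimension_exists)
  have "hausdorff_measure u X = 0" if "t < u" for u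
    using that t powr_sum_strict_antimono[OF I_ne that] X_subset_level
    by (intro hausdorff_measure_Inter_level_null) auto
  moreover have sub: "doubling_points \<mu> \<subseteq> X" using support_\<mu> by (auto simp: doubling_points_def)
  ultimately have null: "hausdorff_measure u A = 0" if "t < u" "A \<subseteq> X" for u A
    using hausdorff_measure_mono[OF that(2), of u] that(1) by simp
  \<comment> \<open>Taking \<open>A = X\<close> in the dimension formula identifies the given
    \<open>s\<close> with the similarity dimension.\<close>
  have "s = t"
    using hausdorff_dim_eq[OF t sub] null t(1) assms(5) by simp
  moreover have "hausdorff_dim (doubling_points \<mu>) = ennreal t"
    using t null sub by (intro hausdorff_dim_eq) auto
  moreover have "hausdorff_measure t (doubling_points \<mu>) = 0"
    using t assms(9) by (rule doubling_points_null)
  ultimately show ?thesis by simp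
qed

end
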